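(* Let $k$ be a field, $A=k[x,y]$ the polynomial ring in two variables, and let $a,b\in A$ satisfy $A/aA\cong k[t,t^{-1}]$ (Laurent polynomial ring in one variable), $A/bA\cong k[t]$, and $A/(aA+bA)\cong k$. Let $B=A[b/a]\subset A_a$. Then: (a) $B$ is a UFD and $B^*=k^*$; (b) if $k$ is algebraically closed, then $X=\mathrm{Spec}(B)$ is a smooth affine factorial surface over $k$ with trivial units (i.e. $\mathcal{O}(X)^*=k^*$).
   Context: $A_a$ denotes the localization of $A$ at the element $a$, and $A[b/a]$ is the subring of $A_a$ generated by $A$ and $b/a$. *)

theory Defs
  imports "HOL-Computational_Algebra.Polynomial"
          "HOL-Computational_Algebra.Fraction_Field"
          "HOL-Algebra.QuotRing"
          "HOL-Algebra.Ring_Divisibility"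
          "HOL-Library.Extended_Nat"
begin

definition ring_of :: "'a::comm_ring_1 set \<Rightarrow> 'a ring" where
  "ring_of S = \<lparr>carrier = S, mult = (*), one = 1, zero = 0, add = (+)\<rparr>"

definition kalg_iso :: "('a, 'c) ring_scheme \<Rightarrow> ('k \<Rightarrow> 'a) \<Rightarrow> ('b, 'd) ring_scheme \<Rightarrow> ('k \<Rightarrow> 'b) \<Rightarrow> bool" where
  "kalg_iso R \<phi> S \<psi> \<longleftrightarrow> (\<exists>h. h \<in> ring_iso R S \<and> (\<forall>c. h (\<phi> c) = \<psi> c))"

text \<open>A = k[x,y], realised as (k[x])[y].\<close>
definition polyA :: "'k::field poly poly ring" where
  "polyA = ring_of UNIV"

definition constA :: "'k::field \<Rightarrow> 'k poly poly" where
  "constA c = [:[:c:]:]"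

definition quotA :: "'k::field poly poly set \<Rightarrow> 'k poly poly set ring" where
  "quotA I = polyA Quot I"

definition const_quotA :: "'k poly poly set \<Rightarrow> 'k::field \<Rightarrow> 'k poly poly set" where
  "const_quotA I c = I +>\<^bsub>polyA\<^esub> constA c"

definition laurent_set :: "'k::field poly fract set" where
  "laurent_set = {Fract p ([:0, 1:] ^ n) | p n. True}"

definition laurent_ring :: "'k::field poly fract ring" where
  "laurent_ring = ring_of laurent_set"

definition const_laurent :: "'k::field \<Rightarrow> 'k poly fract" where
  "const_laurent c = Fract [:c:] 1"

definition poly_ring :: "'k::field poly ring" where
  "poly_ring = ring_of UNIV"

definition field_ring :: "'k::field ring" where
  "field_ring = ring_of UNIV"

definition B_set :: "'k::field poly poly \<Rightarrow> 'k poly poly \<Rightarrow> 'k poly poly fract set" where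
  "B_set a b = {(\<Sum>i\<le>n. Fract (c i) 1 * Fract b a ^ i) | n c. True}"

definition B_ring :: "'k::field poly poly \<Rightarrow> 'k poly poly \<Rightarrow> 'k poly poly fract ring" where
  "B_ring a b = ring_of (B_set a b)"

definition const_frac :: "'k::field \<Rightarrow> 'k poly poly fract" where
  "const_frac c = Fract (constA c) 1"

definition alg_closed_type :: "'k::field itself \<Rightarrow> bool" where
  "alg_closed_type _ \<longleftrightarrow> (\<forall>p :: 'k poly. degree p > 0 \<longrightarrow> (\<exists>z. poly p z = 0))"

definition krull_dim :: "('a, 'b) ring_scheme \<Rightarrow> enat" where
  "krull_dim R = Sup {enat n | n. \<exists>P :: nat \<Rightarrow> 'a set.
      (\<forall>i\<le>n. primeideal (P i) R) \<and> (\<forall>i<n. P i \<subset> P (Suc i))}"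

definition ideal_square :: "('a, 'b) ring_scheme \<Rightarrow> 'a set \<Rightarrow> 'a set" where
  "ideal_square R m = genideal R {x \<otimes>\<^bsub>R\<^esub> y | x y. x \<in> m \<and> y \<in> m}"

definition cotangent_dim_eq ::
    "('a, 'b) ring_scheme \<Rightarrow> ('k::field \<Rightarrow> 'a) \<Rightarrow> 'a set \<Rightarrow> nat \<Rightarrow> bool" where
  "cotangent_dim_eq R \<phi> m d \<longleftrightarrow> (\<exists>f :: nat \<Rightarrow> 'a. (\<forall>i<d. f i \<in> m) \<and>
      (\<forall>g\<in>m. \<exists>c :: nat \<Rightarrow> 'k.
          g \<ominus>\<^bsub>R\<^esub> (finsum R (\<lambda>i. \<phi> (c i) \<otimes>\<^bsub>R\<^esub> f i) {..<d}) \<in> ideal_square R m) \<and>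
      (\<forall>c :: nat \<Rightarrow> 'k.
          finsum R (\<lambda>i. \<phi> (c i) \<otimes>\<^bsub>R\<^esub> f i) {..<d} \<in> ideal_square R m \<longrightarrow> (\<forall>i<d. c i = 0)))"

text \<open>Spec R is a smooth affine surface over the algebraically closed field k
  (R a finitely generated k-domain): R has Krull dimension 2 and is regular at
  every closed point, i.e. dim_k (m/m^2) = 2 for every maximal ideal m.\<close>
definition smooth_affine_surface :: "('a, 'b) ring_scheme \<Rightarrow> ('k::field \<Rightarrow> 'a) \<Rightarrow> bool" where
  "smooth_affine_surface R \<phi> \<longleftrightarrow> krull_dim R = 2 \<and>
      (\<forall>m. maximalideal m R \<longrightarrow> cotangent_dim_eq R \<phi> m 2)"

end

theory Submission
  imports Defs "Berlekamp_Zassenhaus.Unique_Factorization_Poly"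
begin

text \<open>
  Write \<open>T = b/a\<close> and \<open>A = k[x,y]\<close>. Since \<open>a\<close> is prime and does not divide \<open>b\<close>, every relation
  \<open>F(T) = 0\<close> with \<open>F \<in> A[T]\<close> has its coefficients in \<open>(a, b)\<close>; as \<open>A = k + (a, b)\<close>, this gives
  \<open>B/aB = k[T]\<close>, so \<open>a\<close> is a prime element of \<open>B\<close>. Away from \<open>a\<close> nothing changes,
  \<open>B[1/a] = A[1/a]\<close>, and Nagata's argument yields factoriality: the primes of \<open>B\<close> are \<open>a\<close> and the
  strict transforms \<open>f/a^n\<close> of the primes \<open>f\<close> of \<open>A\<close>. What replaces Noetherianity is that a nonzero
  element of \<open>B\<close> is divisible by only finitely many powers of \<open>a\<close>, which is seen on the blowup of the
  point of \<open>A\<close> defined by \<open>(a, b)\<close>.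

  If \<open>k\<close> is algebraically closed, a maximal ideal \<open>m\<close> of \<open>B\<close> containing \<open>a\<close> is \<open>(a, T - c)\<close>, and
  primality of \<open>a\<close> shows that \<open>a\<close> and \<open>T - c\<close> are independent modulo \<open>m\<^sup>2\<close>; a maximal ideal not
  containing \<open>a\<close> lies over a point of the plane, where \<open>m/m\<^sup>2\<close> is computed by partial derivatives.
\<close>

section \<open>Factoriality of subrings of a domain\<close>

text \<open>An element of \<open>B\<close> has many expressions \<open>F(T)\<close>, so it has no
  normal form to compute with. It is controlled by two reductions: clearing denominators,
  \<open>a^N * g = p\<close> with \<open>p\<close> in \<open>A\<close>, sees \<open>g\<close> away
  from \<open>a = 0\<close>, and the map to \<open>B/aB = k[T]\<close> sees it along
  \<open>a = 0\<close>. Primality of \<open>a\<close> in \<open>B\<close> joins them: a quotient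
  found in \<open>B[1/a]\<close> lies in \<open>B\<close> as soon as its product with some element
  of \<open>B\<close> outside \<open>aB\<close> does. The Laurent quotient makes \<open>a\<close>
  prime; the class of \<open>t\<close> in it is not a constant, so \<open>A/aA\<close> is not
  \<open>A/(a, b) = k\<close>, and \<open>a\<close> does not divide \<open>b\<close>. Closed points
  off \<open>a = 0\<close> are found by elimination: two coprime polynomials in a prime ideal give a
  nonzero polynomial in \<open>x\<close> alone, then one in \<open>y\<close>, and these split into
  linear factors. The resulting condition, \<open>B = k + P\<close>, serves as the test for
  maximality. It holds for every prime strictly above a nonzero prime, which bounds the dimension by
  2; the chain \<open>0 < aB < (a, T)\<close> attains the bound.\<close>

lemma ring_of_simps [simp]:
  "carrier (ring_of S) = S" "mult (ring_of S) = (*)" "one (ring_of S) = 1"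
  "zero (ring_of S) = 0" "add (ring_of S) = (+)"
  by (simp_all add: ring_of_def)

text \<open>\<open>B\<close> is a subset of a fraction field and not a type, so ring theory is done
  relative to a carrier \<open>S\<close> inside a domain type, with the operations of the
  type.\<close>

locale subring_set =
  fixes S :: "'a::idom set"
  assumes zero_mem: "0 \<in> S" and one_mem: "1 \<in> S"
    and add_mem: "x \<in> S \<Longrightarrow> y \<in> S \<Longrightarrow> x + y \<in> S"
    and uminus_mem: "x \<in> S \<Longrightarrow> - x \<in> S"
    and mult_mem: "x \<in> S \<Longrightarrow> y \<in> S \<Longrightarrow> x * y \<in> S"
begin

lemma diff_mem: "x \<in> S \<Longrightarrow> y \<in> S \<Longrightarrow> x - y \<in> S"
  using add_mem[of x "- y"] uminus_mem by simp

lemma power_mem: "x \<in> S \<Longrightarrow> x ^ n \<in> S"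
  by (induction n) (auto simp: one_mem mult_mem)

lemma domain_ring_of: "domain (ring_of S)"
proof -
  have "cring (ring_of S)"
  proof (rule cringI)
    show "abelian_group (ring_of S)"
    proof (rule abelian_groupI)
      fix x assume "x \<in> carrier (ring_of S)"
      then show "\<exists>y\<in>carrier (ring_of S). y \<oplus>\<^bsub>ring_of S\<^esub> x = \<zero>\<^bsub>ring_of S\<^esub>"
        by (intro bexI[of _ "- x"]) (auto simp: uminus_mem)
    qed (auto simp: add_mem zero_mem algebra_simps)
    show "comm_monoid (ring_of S)"
      by (rule comm_monoidI) (auto simp: mult_mem one_mem algebra_simps)
  qed (auto simp: algebra_simps)
  then show ?thesis
    by (rule domain.intro) (unfold_locales, auto)
qed

sublocale R: domain "ring_of S"
  rewrites "carrier (ring_of S) = S" and "mult (ring_of S) = (*)" and "one (ring_of S) = 1"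
    and "zero (ring_of S) = 0" and "add (ring_of S) = (+)"
  by (rule domain_ring_of) auto

lemma a_inv_ring_of: "x \<in> S \<Longrightarrow> \<ominus>\<^bsub>ring_of S\<^esub> x = - x"
  using R.minus_equality[of "- x" x] by (simp add: uminus_mem)

lemma a_minus_ring_of: "x \<in> S \<Longrightarrow> y \<in> S \<Longrightarrow> x \<ominus>\<^bsub>ring_of S\<^esub> y = x - y"
  by (simp add: a_minus_def a_inv_ring_of)

lemma finsum_ring_of:
  assumes "\<And>i. i \<in> I \<Longrightarrow> f i \<in> S"
  shows "finsum (ring_of S) f I = sum f I"
proof (cases "finite I")
  case True
  then show ?thesis using assms
  proof (induction I)
    case (insert i I)
    then have "finsum (ring_of S) f (insert i I) = f i + finsum (ring_of S) f I"
      by (subst R.finsum_insert) auto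
    with insert show ?case by simp
  qed simp
qed (simp add: finsum_def finprod_def)

section \<open>Ideals of a subring in elementwise form\<close>

lemma ideal_ring_of_iff:
  "ideal P (ring_of S) \<longleftrightarrow> P \<subseteq> S \<and> 0 \<in> P \<and> (\<forall>x\<in>P. \<forall>y\<in>P. x + y \<in> P) \<and> (\<forall>x\<in>P. \<forall>s\<in>S. s * x \<in> P)"
  (is "_ \<longleftrightarrow> ?R")
proof
  assume "ideal P (ring_of S)"
  then interpret ideal P "ring_of S" .
  show ?R
    using a_subset additive_subgroup.zero_closed[OF additive_subgroup_axioms] a_closed I_l_closed
    by auto
next
  assume R: ?R
  have un: "- x \<in> P" if "x \<in> P" for x
  proof -
    have "(- 1) * x \<in> P"
      using that R one_mem uminus_mem by blast
    then show ?thesis by simp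
  qed
  show "ideal P (ring_of S)"
  proof (rule idealI)
    show "ring (ring_of S)" by (rule R.ring_axioms)
    have inv: "inv\<^bsub>add_monoid (ring_of S)\<^esub> x = - x" if "x \<in> P" for x
      using that R a_inv_ring_of[of x] by (auto simp: a_inv_def)
    show "subgroup P (add_monoid (ring_of S))"
      using R un inv by (intro subgroup.intro) auto
  next
    fix x s assume "x \<in> P" "s \<in> carrier (ring_of S)"
    then show "s \<otimes>\<^bsub>ring_of S\<^esub> x \<in> P" "x \<otimes>\<^bsub>ring_of S\<^esub> s \<in> P"
      using R by (auto simp: mult.commute)
  qed
qed

lemma
  assumes "ideal P (ring_of S)"
  shows ideal_sub: "x \<in> P \<Longrightarrow> x \<in> S"
    and ideal_zero: "0 \<in> P"
    and ideal_add: "x \<in> P \<Longrightarrow> y \<in> P \<Longrightarrow> x + y \<in> P"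
    and ideal_mult: "s \<in> S \<Longrightarrow> x \<in> P \<Longrightarrow> s * x \<in> P"
    and ideal_mult_right: "s \<in> S \<Longrightarrow> x \<in> P \<Longrightarrow> x * s \<in> P"
  using assms by (auto simp: ideal_ring_of_iff mult.commute)

lemma ideal_uminus: "ideal P (ring_of S) \<Longrightarrow> x \<in> P \<Longrightarrow> - x \<in> P"
  using ideal_mult[of P "- 1" x] uminus_mem[OF one_mem] by simp

lemma ideal_diff: "ideal P (ring_of S) \<Longrightarrow> x \<in> P \<Longrightarrow> y \<in> P \<Longrightarrow> x - y \<in> P"
  using ideal_add[of P x "- y"] ideal_uminus by simp

lemma ideal_one: "ideal P (ring_of S) \<Longrightarrow> 1 \<in> P \<Longrightarrow> P = S"
  using ideal_mult_right[of P _ 1] ideal_sub by fastforce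

lemma primeideal_ring_of_iff:
  "primeideal P (ring_of S) \<longleftrightarrow> ideal P (ring_of S) \<and> P \<noteq> S \<and>
     (\<forall>x\<in>S. \<forall>y\<in>S. x * y \<in> P \<longrightarrow> x \<in> P \<or> y \<in> P)"
  using R.is_cring by (auto simp: primeideal_def primeideal_axioms_def)

lemma maximalideal_ring_of_iff:
  "maximalideal P (ring_of S) \<longleftrightarrow> ideal P (ring_of S) \<and> P \<noteq> S \<and>
     (\<forall>J. ideal J (ring_of S) \<longrightarrow> P \<subseteq> J \<longrightarrow> J = P \<or> J = S)"
proof -
  have "J \<subseteq> S" if "ideal J (ring_of S)" for J
    using that ideal_sub by blast
  then show ?thesis
    by (auto simp: maximalideal_def maximalideal_axioms_def)
qed

lemma ideal_ideal_square: "m \<subseteq> S \<Longrightarrow> ideal (ideal_square (ring_of S) m) (ring_of S)"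
  unfolding ideal_square_def by (intro R.genideal_ideal) (auto simp: mult_mem)

lemma mult_in_ideal_square:
  assumes "m \<subseteq> S" "x \<in> m" "y \<in> m"
  shows "x * y \<in> ideal_square (ring_of S) m"
proof -
  let ?G = "{x \<otimes>\<^bsub>ring_of S\<^esub> y |x y. x \<in> m \<and> y \<in> m}"
  have "?G \<subseteq> genideal (ring_of S) ?G"
    using assms(1) by (intro R.genideal_self) (auto simp: mult_mem)
  moreover have "x * y \<in> ?G" using assms by auto
  ultimately show ?thesis unfolding ideal_square_def by blast
qed

lemma ideal_square_subset:
  assumes "ideal J (ring_of S)" "\<And>x y. x \<in> m \<Longrightarrow> y \<in> m \<Longrightarrow> x * y \<in> J"
  shows "ideal_square (ring_of S) m \<subseteq> J"
  unfolding ideal_square_def using assms by (intro R.genideal_minimal) auto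

text \<open>In a fraction field the type-level \<open>dvd\<close> is trivial; divisibility, units
  and primes must be relative to \<open>S\<close>.\<close>

definition dvd_in :: "'a \<Rightarrow> 'a \<Rightarrow> bool" where
  "dvd_in x y \<longleftrightarrow> (\<exists>z\<in>S. y = x * z)"

definition unit_in :: "'a \<Rightarrow> bool" where
  "unit_in x \<longleftrightarrow> x \<in> S \<and> dvd_in x 1"

definition prime_in :: "'a \<Rightarrow> bool" where
  "prime_in p \<longleftrightarrow> p \<in> S \<and> p \<noteq> 0 \<and> \<not> dvd_in p 1 \<and>
     (\<forall>x\<in>S. \<forall>y\<in>S. dvd_in p (x * y) \<longrightarrow> dvd_in p x \<or> dvd_in p y)"

inductive prime_prod :: "'a \<Rightarrow> bool" where
  unit: "unit_in u \<Longrightarrow> prime_prod u"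
| step: "prime_in p \<Longrightarrow> prime_prod x \<Longrightarrow> prime_prod (p * x)"

lemma Units_ring_of: "Units (ring_of S) = Collect unit_in"
  unfolding Units_def unit_in_def dvd_in_def by (auto simp: mult.commute; metis mult.commute)

lemma prime_prod_mem: "prime_prod x \<Longrightarrow> x \<in> S"
  by (induction rule: prime_prod.induct) (auto simp: unit_in_def prime_in_def mult_mem)

lemma prime_prod_nonzero: "prime_prod x \<Longrightarrow> x \<noteq> 0"
  by (induction rule: prime_prod.induct) (auto simp: unit_in_def prime_in_def dvd_in_def)

lemma prime_prod_prime: "prime_in p \<Longrightarrow> prime_prod p"
  using prime_prod.step[OF _ prime_prod.unit, of p 1]
  by (force simp: unit_in_def dvd_in_def one_mem)

lemma unit_in_mult: "unit_in u \<Longrightarrow> unit_in v \<Longrightarrow> unit_in (u * v)"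
proof -
  assume uv: "unit_in u" "unit_in v"
  then obtain u' v' where "u' \<in> S" "v' \<in> S" "1 = u * u'" "1 = v * v'"
    by (auto simp: unit_in_def dvd_in_def)
  then have "1 = (u * v) * (u' * v')" "u' * v' \<in> S"
    by (simp_all add: mult_mem) (metis mult.assoc mult.left_commute mult_1)
  then show ?thesis
    using uv by (auto simp: unit_in_def dvd_in_def mult_mem)
qed

lemma prime_prod_unit_mult: "prime_prod x \<Longrightarrow> unit_in u \<Longrightarrow> prime_prod (u * x)"
proof (induction rule: prime_prod.induct)
  case (step p x)
  then show ?case
    using prime_prod.step[of p "u * x"] by (simp add: mult.left_commute)
qed (simp add: prime_prod.unit unit_in_mult)

lemma prime_prod_mult: "prime_prod x \<Longrightarrow> prime_prod y \<Longrightarrow> prime_prod (x * y)"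
  by (induction rule: prime_prod.induct) (auto simp: prime_prod_unit_mult prime_prod.step mult.assoc)

lemma prime_prod_power: "prime_prod x \<Longrightarrow> prime_prod (x ^ n)"
  by (induction n) (auto intro: prime_prod.unit prime_prod_mult simp: unit_in_def dvd_in_def one_mem)

text \<open>The cancellation half of Nagata's argument. \<open>p\<close> divides the first prime
  \<open>q\<close> or the remaining product: in the first case \<open>p\<close> and \<open>q\<close>
  are associates and \<open>g\<close> differs from the rest by a unit, in the second the induction
  continues inside the rest.\<close>

lemma prime_prod_cancel:
  assumes "prime_prod x" "prime_in p" "g \<in> S" "x = p * g"
  shows "prime_prod g"
  using assms
proof (induction arbitrary: g rule: prime_prod.induct)
  case (unit u)
  then show ?case
    by (auto simp: unit_in_def dvd_in_def prime_in_def mult_mem mult.assoc)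
next
  case (step q x)
  have xS: "x \<in> S" using step prime_prod_mem by blast
  have "dvd_in p (q * x)" using step by (auto simp: dvd_in_def)
  then have "dvd_in p q \<or> dvd_in p x"
    using step.hyps step.prems xS unfolding prime_in_def by blast
  then consider "dvd_in p q" | "dvd_in p x" by blast
  then show ?case
  proof cases
    case 1
    then obtain e where e: "e \<in> S" "q = p * e" by (auto simp: dvd_in_def)
    \<comment> \<open>The prime \<open>q\<close> divides \<open>p * e = q\<close>; if it divided
      \<open>e\<close>, then \<open>p\<close> would be a unit.\<close>
    then have "dvd_in q p \<or> dvd_in q e"
      using step.hyps(1) step.prems(1) unfolding prime_in_def dvd_in_def
      by (metis mult.right_neutral one_mem)
    moreover have False if de: "dvd_in q e"
    proof -
      obtain w where "w \<in> S" "e = q * w" using de by (auto simp: dvd_in_def)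
      with e have "q * 1 = q * (p * w)" by (metis mult.commute mult.left_commute mult_1)
      then have "1 = p * w"
        using step.hyps(1) unfolding prime_in_def by (metis mult_left_cancel)
      then show False using step.prems(1) \<open>w \<in> S\<close> by (auto simp: prime_in_def dvd_in_def)
    qed
    ultimately obtain w where w: "w \<in> S" "p = q * w" by (auto simp: dvd_in_def)
    with e have "p * 1 = p * (e * w)" by (metis mult.assoc mult.right_neutral)
    then have ew: "1 = e * w" using step.prems(1) unfolding prime_in_def by (metis mult_left_cancel)
    then have "unit_in e" using e w by (auto simp: unit_in_def dvd_in_def)
    moreover have "g = e * x"
      using step.prems e unfolding prime_in_def by (metis mult.assoc mult_left_cancel)
    ultimately show ?thesis using step.hyps(2) prime_prod_unit_mult by simp
  next
    case 2
    then obtain e where e: "e \<in> S" "x = p * e" by (auto simp: dvd_in_def)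
    then have "prime_prod e" using step.IH step.prems(1) by blast
    moreover have "g = q * e"
    proof -
      have "p * g = p * (q * e)" using step.prems(3) e(2) by (metis mult.left_commute)
      then show ?thesis using step.prems(1) unfolding prime_in_def by (metis mult_left_cancel)
    qed
    ultimately show ?thesis using step.hyps(1) prime_prod.step by blast
  qed
qed

lemma prime_prod_cancel_power:
  assumes "prime_in p" "g \<in> S" "prime_prod (p ^ n * g)"
  shows "prime_prod g"
  using assms(3)
proof (induction n)
  case (Suc n)
  have "p ^ n * g \<in> S" using assms by (auto simp: prime_in_def mult_mem power_mem)
  then show ?case using Suc prime_prod_cancel[of "p ^ Suc n * g" p "p ^ n * g"] assms
    by (simp add: mult.assoc)
qed simp

text \<open>Existence of prime factorizations already yields uniqueness: if an irreducible
  \<open>x\<close> is \<open>p * y\<close> with \<open>p\<close> prime, then \<open>p\<close> cannot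
  be a proper factor, so \<open>y\<close> is a unit and \<open>x\<close> inherits primality from
  \<open>p\<close>.\<close>

lemma factorial_domain_ring_ofI:
  assumes "\<And>x. x \<in> S \<Longrightarrow> x \<noteq> 0 \<Longrightarrow> prime_prod x"
  shows "factorial_domain (ring_of S)"
proof -
  let ?M = "mult_of (ring_of S)"
  have divM: "x divides\<^bsub>?M\<^esub> y \<longleftrightarrow> dvd_in x y" if "y \<noteq> 0" for x y
    using that by (auto simp: factor_def dvd_in_def)
  have UM: "x \<in> Units ?M \<longleftrightarrow> unit_in x" for x
    by (simp add: Units_ring_of)
  have cM: "carrier ?M = S - {0}" by simp
  have mM: "mult ?M = (*)" by simp
  have primeM: "Divisibility.prime ?M p" if "prime_in p" for p
  proof (rule primeI)
    show "p \<notin> Units ?M" using that by (auto simp: Units_ring_of prime_in_def unit_in_def)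
    fix x y assume xy: "x \<in> carrier ?M" "y \<in> carrier ?M" "p divides\<^bsub>?M\<^esub> x \<otimes>\<^bsub>?M\<^esub> y"
    then have "dvd_in p (x * y)" "x \<noteq> 0" "y \<noteq> 0" "x \<in> S" "y \<in> S"
      using divM[of "x * y" p] by (auto simp: cM mM)
    then show "p divides\<^bsub>?M\<^esub> x \<or> p divides\<^bsub>?M\<^esub> y"
      using that divM by (auto simp: prime_in_def)
  qed
  have wf: "\<exists>fs. set fs \<subseteq> carrier ?M \<and> wfactors ?M fs x \<and> (\<forall>f\<in>set fs. prime_in f)"
    if "prime_prod x" for x
    using that
  proof (induction rule: prime_prod.induct)
    case (unit u)
    then have "wfactors ?M [] u" by (intro R.mult_of.unit_wfactors) (simp add: Units_ring_of)
    then show ?case by (intro exI[of _ "[]"]) simp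
  next
    case (step p x)
    then obtain fs where fs: "set fs \<subseteq> carrier ?M" "wfactors ?M fs x" "\<forall>f\<in>set fs. prime_in f"
      by blast
    have "Divisibility.irreducible ?M p"
      using R.mult_of.prime_irreducible primeM step by blast
    moreover have pc: "p \<in> carrier ?M" "x \<in> carrier ?M"
      using step prime_prod_mem prime_prod_nonzero by (auto simp: cM prime_in_def)
    ultimately have "wfactors ?M (p # fs) (p * x)"
      using R.mult_of.wfactors_mult_single[of p fs x] fs by simp
    then show ?case using fs pc step by (intro exI[of _ "p # fs"]) auto
  qed
  interpret M: primeness_condition_monoid ?M
  proof (unfold_locales)
    fix x assume x: "x \<in> carrier ?M" "Divisibility.irreducible ?M x"
    then have xS: "x \<in> S" "x \<noteq> 0" by (auto simp: cM)
    have nu: "\<not> unit_in x" using x(2) by (auto simp: Divisibility.irreducible_def Units_ring_of)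
    from assms[OF xS] show "Divisibility.prime ?M x"
    proof cases
      case unit
      with nu show ?thesis by simp
    next
      case (step p y)
      have pc: "p \<in> carrier ?M" "y \<in> carrier ?M"
        using step prime_prod_mem prime_prod_nonzero by (auto simp: cM prime_in_def)
      have pnu: "p \<notin> Units ?M" using step by (auto simp: Units_ring_of prime_in_def unit_in_def)
      have "\<not> Divisibility.properfactor ?M p x"
        using x(2) pc pnu by (auto simp: Divisibility.irreducible_def)
      moreover have "p divides\<^bsub>?M\<^esub> x" using step pc by (auto simp: factor_def cM mM)
      ultimately have "x divides\<^bsub>?M\<^esub> p" by (auto simp: Divisibility.properfactor_def)
      then obtain w where w: "w \<in> S" "p = x * w" using pc by (auto simp: divM dvd_in_def cM)
      then have "p * 1 = p * (y * w)" using step(1) by (metis mult.assoc mult.right_neutral)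
      then have "1 = y * w" using step unfolding prime_in_def by (metis mult_left_cancel)
      then have uy: "unit_in y" using w pc by (auto simp: unit_in_def dvd_in_def cM)
      then have "unit_in w" using w pc \<open>1 = y * w\<close> 
        by (auto simp: unit_in_def dvd_in_def cM mult.commute)
      have dvdx: "dvd_in x z \<longleftrightarrow> dvd_in p z" if "z \<in> S" for z
      proof
        assume "dvd_in x z"
        then obtain v where "v \<in> S" "z = x * v" by (auto simp: dvd_in_def)
        then have "z = p * (y * v)" "y * v \<in> S" using step pc by (auto simp: mult_mem cM mult.assoc)
        then show "dvd_in p z" by (auto simp: dvd_in_def)
      next
        assume "dvd_in p z"
        then show "dvd_in x z" using w by (auto simp: dvd_in_def mult_mem mult.assoc)
      qed
      have "prime_in x"
        using step(2) xS nu dvdx by (auto simp: prime_in_def mult_mem one_mem unit_in_def)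
      then show ?thesis by (rule primeM)
    qed
  qed
  have "factorial_monoid ?M"
  proof (rule R.mult_of.factorial_monoidI)
    fix x assume "x \<in> carrier ?M"
    then have "prime_prod x" using assms by (auto simp: cM)
    from wf[OF this] show "\<exists>fs. set fs \<subseteq> carrier ?M \<and> wfactors ?M fs x" by blast
  next
    fix x fs fs' assume "x \<in> carrier ?M" "set fs \<subseteq> carrier ?M" "set fs' \<subseteq> carrier ?M"
        "wfactors ?M fs x" "wfactors ?M fs' x"
    then show "essentially_equal ?M fs fs'" using M.wfactors_unique by blast
  qed
  then show ?thesis using domain_ring_of by (simp add: factorial_domain_def)
qed

end

section \<open>The quotient hypotheses\<close>

interpretation U: subring_set UNIV
  by unfold_locales auto

text \<open>Removes cosets once and for all: \<open>f\<close> is the composite of the quotient map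
  with the isomorphism, and injectivity of the latter turns \<open>f x = 0\<close> into equality of
  the cosets of \<open>x\<close> and \<open>0\<close>.\<close>

lemma kalg_iso_quotA_hom:
  assumes I: "ideal I polyA" and iso: "kalg_iso (quotA I) (const_quotA I) (ring_of S) \<psi>"
  obtains f where "\<And>x y. f (x + y) = f x + f y" "\<And>x y. f (x * y) = f x * f y" "f 1 = 1"
    "range f = S" "\<And>x. f x = 0 \<longleftrightarrow> x \<in> I" "\<And>c. f (constA c) = \<psi> c"
proof -
  interpret I: ideal I polyA by (rule I)
  obtain h where h: "h \<in> Ring.ring_hom (polyA Quot I) (ring_of S)"
      "bij_betw h (carrier (polyA Quot I)) S"
      "\<And>c. h (I +>\<^bsub>polyA\<^esub> constA c) = \<psi> c"
    using iso unfolding kalg_iso_def quotA_def const_quotA_def ring_iso_def by auto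
  have q: "(+>\<^bsub>polyA\<^esub>) I \<in> Ring.ring_hom polyA (polyA Quot I)" by (rule I.rcos_ring_hom)
  have sel: "carrier polyA = UNIV" "mult polyA = (*)" "one polyA = 1" "add polyA = (+)"
     "zero polyA = 0"
    by (simp_all add: polyA_def)
  define f where "f x = h (I +>\<^bsub>polyA\<^esub> x)" for x
  have carr: "I +>\<^bsub>polyA\<^esub> x \<in> carrier (polyA Quot I)" for x
    using ring_hom_closed[OF q] by (simp add: sel)
  have surj: "carrier (polyA Quot I) = range ((+>\<^bsub>polyA\<^esub>) I)"
    by (auto simp: FactRing_def A_RCOSETS_def' sel)
  have add: "f (x + y) = f x + f y" for x y
    using ring_hom_add[OF q, of x y] ring_hom_add[OF h(1) carr carr, of x y]
    by (simp add: sel f_def)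
  have mult: "f (x * y) = f x * f y" for x y
    using ring_hom_mult[OF q, of x y] ring_hom_mult[OF h(1) carr carr, of x y]
    by (simp add: sel f_def)
  have one: "f 1 = 1"
    using ring_hom_one[OF q] ring_hom_one[OF h(1)] by (simp add: sel f_def)
  have f0: "f 0 = 0" using add[of 0 0] by simp
  have ker: "f x = 0 \<longleftrightarrow> x \<in> I" for x
  proof -
    have "f x = 0 \<longleftrightarrow> I +>\<^bsub>polyA\<^esub> x = I +>\<^bsub>polyA\<^esub> 0"
      using h(2) carr f0 unfolding f_def bij_betw_def inj_on_def by metis
    also have "\<dots> \<longleftrightarrow> x \<in> I"
    proof
      assume e: "I +>\<^bsub>polyA\<^esub> x = I +>\<^bsub>polyA\<^esub> 0"
      have "0 \<in> I" using additive_subgroup.zero_closed[OF I.additive_subgroup_axioms] by (simp add: sel)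
      then have "x \<in> I +>\<^bsub>polyA\<^esub> x" unfolding a_r_coset_def' by (force simp: sel)
      with e show "x \<in> I" unfolding a_r_coset_def' by (auto simp: sel)
    next
      assume "x \<in> I"
      then show "I +>\<^bsub>polyA\<^esub> x = I +>\<^bsub>polyA\<^esub> 0"
        using I.a_rcos_const[of x] I.a_rcos_const[of 0] additive_subgroup.zero_closed[OF I.additive_subgroup_axioms] by (simp add: sel)
    qed
    finally show ?thesis .
  qed
  have rng: "range f = S"
    using h(2) unfolding bij_betw_def surj f_def by (auto simp: image_image)
  have con: "f (constA c) = \<psi> c" for c by (simp add: f_def h(3))
  show thesis by (rule that[OF add mult one rng ker con])
qed

lemma PIdl_polyA: "PIdl\<^bsub>polyA\<^esub> a = range (\<lambda>x. x * a)"
  unfolding cgenideal_def polyA_def by auto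

lemma ideal_PIdl_polyA: "ideal (PIdl\<^bsub>polyA\<^esub> a) polyA"
  unfolding polyA_def by (rule U.R.cgenideal_ideal) simp

lemma genideal_polyA2: "genideal polyA {a, b} = {u * a + v * b |u v. True}"
proof
  let ?J = "{u * a + v * b |u v. True}"
  have J: "ideal ?J polyA"
    unfolding polyA_def U.ideal_ring_of_iff
  proof (intro conjI ballI)
    show "0 \<in> ?J" by (auto intro!: exI[of _ 0])
    fix x y assume x: "x \<in> ?J" "y \<in> ?J"
    then obtain u v u' v' where "x = u * a + v * b" "y = u' * a + v' * b" by blast
    then have "x + y = (u + u') * a + (v + v') * b" by (simp add: algebra_simps)
    then show "x + y \<in> ?J" by blast
  next
    fix x s assume "x \<in> ?J"
    then obtain u v where "x = u * a + v * b" by blast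
    then have "s * x = (s * u) * a + (s * v) * b" by (simp add: algebra_simps)
    then show "s * x \<in> ?J" by blast
  qed simp
  have "a = 1 * a + 0 * b" "b = 0 * a + 1 * b" by simp_all
  then have "a \<in> ?J" "b \<in> ?J" by blast+
  then show "genideal polyA {a, b} \<subseteq> ?J"
    using U.R.genideal_minimal[OF J[unfolded polyA_def], of "{a, b}"]
    unfolding polyA_def by blast
  have I: "ideal (genideal polyA {a, b}) (ring_of UNIV)"
    unfolding polyA_def by (rule U.R.genideal_ideal) simp
  have ab: "{a, b} \<subseteq> genideal polyA {a, b}"
    unfolding polyA_def by (rule U.R.genideal_self) simp
  have "u * a + v * b \<in> genideal polyA {a, b}" for u v
    using ab by (intro U.ideal_add[OF I] U.ideal_mult[OF I]) simp_all
  then show "?J \<subseteq> genideal polyA {a, b}" by blast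
qed

lemma is_unit_constA: "is_unit p \<Longrightarrow> \<exists>c. c \<noteq> 0 \<and> p = constA c"
  for p :: "'k::field poly poly"
proof -
  assume "is_unit p"
  then obtain q where q: "p = [:q:]" "is_unit q" by (auto simp: is_unit_poly_iff)
  then obtain c where "q = [:c:]" "c \<noteq> 0" by (auto elim!: degree_eq_zeroE)
  with q show ?thesis by (auto simp: constA_def)
qed

lemma constA_simps [simp]:
  "constA 0 = 0" "constA 1 = 1" "constA (c + d) = constA c + constA d"
  "constA (c * d) = constA c * constA d" "constA (- c) = - constA c"
  "constA (c - d) = constA c - constA d" "constA c = 0 \<longleftrightarrow> c = 0"
  "constA c = constA d \<longleftrightarrow> c = d"
  by (simp_all add: constA_def pCons_one)

text \<open>The Laurent ring sits inside a field, so products vanish in it only trivially, which is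
  primality of the kernel generator. It remains to exclude \<open>a = 0\<close>: the element
  \<open>t\<close> is invertible and not a constant, whereas all units of \<open>A\<close> are
  constants. A lift of \<open>t\<close> is the required \<open>z\<close>.\<close>

lemma
  fixes a :: "'k::field poly poly"
  assumes "kalg_iso (quotA (PIdl\<^bsub>polyA\<^esub> a)) (const_quotA (PIdl\<^bsub>polyA\<^esub> a))
                    laurent_ring const_laurent"
  shows quot_laurent_prime: "prime_elem a"
    and quot_laurent_nonconst: "\<exists>z. \<forall>c w. z \<noteq> constA c + w * a"
proof -
  obtain f where f: "\<And>x y. f (x + y) = f x + f y" "\<And>x y. f (x * y) = f x * f y" "f 1 = 1"
    "range f = (laurent_set :: 'k poly fract set)" "\<And>x. f x = 0 \<longleftrightarrow> x \<in> PIdl\<^bsub>polyA\<^esub> a"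
    "\<And>c. f (constA c) = const_laurent c"
    by (rule kalg_iso_quotA_hom[OF ideal_PIdl_polyA assms[unfolded laurent_ring_def]])
      (rule that; assumption)
  have ker: "f x = 0 \<longleftrightarrow> a dvd x" for x
    unfolding f(5) PIdl_polyA by (auto simp: dvd_def mult.commute)
  have t: "Fract [:0, 1:] 1 \<in> (laurent_set :: 'k poly fract set)"
    unfolding laurent_set_def by (intro CollectI exI[of _ "[:0, 1:]"] exI[of _ "0::nat"]) simp
  have t': "Fract 1 [:0, 1:] \<in> (laurent_set :: 'k poly fract set)"
    unfolding laurent_set_def by (intro CollectI exI[of _ "1"] exI[of _ "1::nat"]) simp
  have tc: "Fract [:0, 1:] 1 \<noteq> const_laurent c" for c :: 'k
    by (auto simp: const_laurent_def eq_fract)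
  obtain z where z: "f z = Fract [:0, 1:] 1" using t f(4) by (metis imageE)
  obtain z' where z': "f z' = Fract 1 [:0, 1:]" using t' f(4) by (metis imageE)
  have "f (z * z') = 1" by (simp add: f z z' One_fract_def eq_fract)
  then have "f (z * z' - 1) = 0"
    using f(1)[of "z * z' - 1" 1] f(3) by simp
  then have "a dvd z * z' - 1" by (simp add: ker)
  have "a \<noteq> 0"
  proof
    assume "a = 0"
    with \<open>a dvd z * z' - 1\<close> have "z * z' = 1" by simp
    then have "is_unit z" by (metis dvd_triv_left)
    then obtain c where "z = constA c" using is_unit_constA by blast
    then show False using z f(6) tc by metis
  qed
  moreover have "\<not> is_unit a" using ker[of 1] f(3) by simp
  moreover have "a dvd x \<or> a dvd y" if "a dvd x * y" for x y
  proof -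
    have "f x * f y = 0" using that f(2)[of x y] ker[of "x * y"] by simp
    then show ?thesis using ker[of x] ker[of y] by auto
  qed
  ultimately show "prime_elem a" by (rule prime_elemI)
  have "z \<noteq> constA c + w * a" for c w
    using tc[of c] z f(1)[of "constA c" "w * a"] f(6)[of c] ker[of "w * a"] by auto
  then show "\<exists>z. \<forall>c w. z \<noteq> constA c + w * a" by blast
qed

lemma
  fixes a b :: "'k::field poly poly"
  assumes "kalg_iso (quotA (genideal polyA {a, b})) (const_quotA (genideal polyA {a, b}))
                    field_ring id"
  shows quot_field_decomp: "\<exists>c u v. z = constA c + u * a + v * b"
    and quot_field_proper: "u * a + v * b \<noteq> 1"
proof -
  have "ideal (genideal polyA {a, b}) polyA"
    unfolding polyA_def by (rule U.R.genideal_ideal) simp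
  then obtain f where f: "\<And>x y. f (x + y) = f x + f y" "\<And>x y. f (x * y) = f x * f y" "f 1 = 1"
    "\<And>x. f x = 0 \<longleftrightarrow> x \<in> genideal polyA {a, b}" "\<And>c. f (constA c) = id c"
    by (rule kalg_iso_quotA_hom[OF _ assms[unfolded field_ring_def]]) (rule that; assumption)
  \<comment> \<open>\<open>f\<close> takes values in \<open>k\<close> and fixes constants, so
    \<open>f z\<close> is the constant to subtract.\<close>
  have "f (z - constA (f z)) = 0"
    using f(1)[of "z - constA (f z)" "constA (f z)"] f(5) by simp
  then obtain u' v' where "z - constA (f z) = u' * a + v' * b"
    unfolding f(4) genideal_polyA2 by blast
  then show "\<exists>c u v. z = constA c + u * a + v * b"
    by (intro exI[of _ "f z"] exI[of _ u'] exI[of _ v']) (simp add: algebra_simps)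
  show "u * a + v * b \<noteq> 1"
  proof
    assume "u * a + v * b = 1"
    then have "1 \<in> genideal polyA {a, b}" unfolding genideal_polyA2 by force
    then show False using f(3) f(4)[of 1] by simp
  qed
qed

section \<open>Polynomials in two variables\<close>

lemma prime_power_dvd_cancel:
  fixes s :: "'a::idom"
  assumes "prime_elem s" "\<not> s dvd c" "s ^ n dvd c * f"
  shows "s ^ n dvd f"
  using assms(3)
proof (induction n arbitrary: f)
  case (Suc n)
  have "s dvd c * f" using Suc.prems by (auto elim: dvd_trans[rotated])
  then obtain f' where f': "f = s * f'"
    using prime_elem_dvd_multD[OF assms(1)] assms(2) by (metis dvdE)
  have "s * s ^ n dvd s * (c * f')" using Suc.prems by (simp add: f' mult.left_commute)
  then have "s ^ n dvd c * f'" using assms(1) by (subst (asm) dvd_mult_cancel_left) auto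
  then have "s ^ n dvd f'" by (rule Suc.IH)
  then show ?case unfolding f' power_Suc by (intro mult_dvd_mono) simp_all
qed simp

lemma prime_elem_power_eqD:
  fixes a :: "'a::idom"
  assumes "prime_elem a" "p * q = a ^ n"
  shows "\<exists>j e. e dvd 1 \<and> p = e * a ^ j"
  using assms(2)
proof (induction n arbitrary: p q)
  case 0
  then have "p dvd 1" by (metis dvd_triv_left power_0)
  then show ?case by (intro exI[of _ "0::nat"] exI[of _ p]) simp
next
  case (Suc n)
  have a0: "a \<noteq> 0" using assms(1) by auto
  have "a dvd p * q" using Suc.prems by simp
  from prime_elem_dvd_multD[OF assms(1) this] consider "a dvd p" | "a dvd q" by blast
  then show ?case
  proof cases
    case 1
    then obtain p' where p': "p = a * p'" by (elim dvdE)
    then have "p' * q = a ^ n" using Suc.prems a0 by (simp add: mult.assoc)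
    then obtain j e where "e dvd 1" "p' = e * a ^ j" using Suc.IH by blast
    then show ?thesis
      by (intro exI[of _ "Suc j"] exI[of _ e]) (simp add: p' mult.left_commute)
  next
    case 2
    then obtain q' where q': "q = a * q'" by (elim dvdE)
    then have "p * q' = a ^ n" using Suc.prems a0 by (simp add: mult.left_commute)
    then show ?thesis using Suc.IH by blast
  qed
qed

text \<open>A weak resultant: a nonzero element of least degree of the ideal \<open>(f, g)\<close> divides both
  generators up to constants, so it is constant when \<open>f\<close> is prime and does not divide \<open>g\<close>.\<close>

lemma prime_poly_elimination:
  fixes f g :: "'a::idom poly"
  assumes f: "prime_elem f" "degree f > 0" and fg: "\<not> f dvd g"
  shows "\<exists>r u v. r \<noteq> 0 \<and> [:r:] = u * f + v * g"
proof -
  define J where "J = {h. h \<noteq> 0 \<and> (\<exists>u v. h = u * f + v * g)}"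
  have f0: "f \<noteq> 0" using f(1) by auto
  have "f = 1 * f + 0 * g" "g = 0 * f + 1 * g" by simp_all
  then have gens: "\<exists>u v. f = u * f + v * g" "\<exists>u v. g = u * f + v * g" by blast+
  then have "f \<in> J" using f0 by (simp add: J_def)
  define h where "h = arg_min degree (\<lambda>h. h \<in> J)"
  have hJ: "h \<in> J" unfolding h_def by (rule arg_min_natI) (fact \<open>f \<in> J\<close>)
  have min: "degree h \<le> degree x" if "x \<in> J" for x
    unfolding h_def by (rule arg_min_nat_le) (fact that)
  have h0: "h \<noteq> 0" using hJ by (simp add: J_def)
  obtain u v where uv: "h = u * f + v * g" using hJ by (auto simp: J_def)
  \<comment> \<open>Over a domain division needs a power of the leading coefficient, whence the
    constant \<open>c\<close>; the remainder lies in the ideal and has smaller degree than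
    \<open>h\<close>, so it vanishes by minimality.\<close>
  have div: "\<exists>c q. c \<noteq> 0 \<and> Polynomial.smult c x = h * q" if x: "\<exists>u v. x = u * f + v * g" for x
  proof -
    obtain q r where qr: "pseudo_divmod x h = (q, r)" by force
    define c where "c = Polynomial.lead_coeff h ^ (Suc (degree x) - degree h)"
    have e: "Polynomial.smult c x = h * q + r" "r = 0 \<or> degree r < degree h"
      using pseudo_divmod[OF h0 qr] by (auto simp: c_def)
    obtain u' v' where x': "x = u' * f + v' * g" using x by blast
    have "r = (Polynomial.smult c u' - u * q) * f + (Polynomial.smult c v' - v * q) * g"
    proof -
      have "r = Polynomial.smult c x - h * q" using e(1) by simp
      then show ?thesis unfolding uv x' by (simp add: algebra_simps smult_add_right)
    qed
    then have "r \<in> J" if "r \<noteq> 0" using that unfolding J_def by blast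
    then have "r = 0" using min[of r] e(2) by fastforce
    moreover have "c \<noteq> 0" using h0 by (simp add: c_def)
    ultimately show ?thesis using e(1) by auto
  qed
  obtain c q where c: "c \<noteq> 0" "Polynomial.smult c f = h * q" using div[OF gens(1)] by blast
  obtain c' q' where c': "c' \<noteq> 0" "Polynomial.smult c' g = h * q'" using div[OF gens(2)] by blast
  have nd: "\<not> f dvd [:c':]"
  proof
    assume "f dvd [:c':]"
    then have "degree f \<le> degree [:c':]" using c'(1) by (intro dvd_imp_degree_le) auto
    then show False using f(2) by simp
  qed
  \<comment> \<open>If \<open>f\<close> divided \<open>h\<close>, it would divide
    \<open>c' * g\<close>. So it divides \<open>q\<close>, and cancelling \<open>f\<close> leaves
    \<open>c = h * w\<close>, which forces \<open>h\<close> to have degree 0.\<close>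
  have "f dvd h * q" using c(2) by (metis dvd_refl dvd_smult)
  moreover have "\<not> f dvd h"
  proof
    assume "f dvd h"
    then have "f dvd [:c':] * g" using c'(2) by simp
    then show False using prime_elem_dvd_multD[OF f(1)] fg nd by blast
  qed
  ultimately have "f dvd q" using prime_elem_dvd_multD[OF f(1)] by blast
  then obtain w where "q = f * w" by (elim dvdE)
  with c(2) have "f * [:c:] = f * (h * w)" by (simp add: mult.left_commute)
  then have "[:c:] = h * w" using f0 by (metis mult_left_cancel)
  then have "degree h = 0"
    using c(1) by (metis degree_pCons_0 degree_mult_eq add_is_0 mult_eq_0_iff pCons_eq_0_iff)
  then obtain r where "h = [:r:]" by (elim degree_eq_zeroE)
  moreover from this have "r \<noteq> 0" using h0 by auto
  ultimately show ?thesis using uv by metis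
qed

text \<open>In \<open>(k[x])[y]\<close> the variable \<open>x\<close> is the constant polynomial
  \<open>[:[:0, 1:]:]\<close> and \<open>y\<close> is \<open>[:0, 1:]\<close>; the two shifts are
  \<open>x - x0\<close> and \<open>y - y0\<close>.\<close>

definition shiftX :: "'k::field \<Rightarrow> 'k poly poly" where "shiftX x0 = [:[:- x0, 1:]:]"
definition shiftY :: "'k::field \<Rightarrow> 'k poly poly" where "shiftY y0 = [:[:- y0:], 1:]"
definition eval2 :: "'k::field \<Rightarrow> 'k \<Rightarrow> 'k poly poly \<Rightarrow> 'k" where
  "eval2 x0 y0 p = poly (poly p [:y0:]) x0"

lemma eval2_simps [simp]:
  "eval2 x0 y0 (p + q) = eval2 x0 y0 p + eval2 x0 y0 q"
  "eval2 x0 y0 (p - q) = eval2 x0 y0 p - eval2 x0 y0 q"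
  "eval2 x0 y0 (p * q) = eval2 x0 y0 p * eval2 x0 y0 q"
  "eval2 x0 y0 (p ^ n) = eval2 x0 y0 p ^ n"
  "eval2 x0 y0 (constA c) = c" "eval2 x0 y0 0 = 0" "eval2 x0 y0 1 = 1"
  "eval2 x0 y0 (shiftX x0) = 0" "eval2 x0 y0 (shiftY y0) = 0"
  by (simp_all add: eval2_def constA_def shiftX_def shiftY_def)

text \<open>Division by \<open>y - y0\<close> leaves a polynomial \<open>r\<close> in
  \<open>x\<close> alone, which is then divided by \<open>x - x0\<close>.\<close>

lemma eval2_decomp:
  "\<exists>u v. p = constA (eval2 x0 y0 p) + shiftX x0 * u + shiftY y0 * v"
proof -
  define r where "r = poly p [:y0:]"
  have "poly (p - [:r:]) [:y0:] = 0" by (simp add: r_def)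
  then obtain v where v: "p - [:r:] = [:- [:y0:], 1:] * v" unfolding poly_eq_0_iff_dvd by (elim dvdE)
  have "poly (r - [:poly r x0:]) x0 = 0" by simp
  then obtain u where u: "r - [:poly r x0:] = [:- x0, 1:] * u" unfolding poly_eq_0_iff_dvd by (elim dvdE)
  have "[:r:] = constA (eval2 x0 y0 p) + shiftX x0 * [:u:]"
  proof -
    have "r = [:poly r x0:] + [:- x0, 1:] * u" using u by (metis add.commute diff_add_cancel)
    then have "[:r:] = [:[:poly r x0:] + [:- x0, 1:] * u:]" by simp
    then show ?thesis by (simp add: constA_def shiftX_def eval2_def r_def)
  qed
  moreover have "p = [:r:] + shiftY y0 * v" using v by (simp add: shiftY_def algebra_simps)
  ultimately show ?thesis by metis
qed

text \<open>Taylor expansion to first order, obtained by expanding both cofactors of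
  \<open>eval2_decomp\<close> once more; it isolates the linear part modulo the square of the ideal
  of the point.\<close>

lemma eval2_eq_0_decomp2:
  assumes "eval2 x0 y0 p = 0"
  shows "\<exists>\<alpha> \<beta> u v w. p = constA \<alpha> * shiftX x0 + constA \<beta> * shiftY y0 +
     (shiftX x0 * shiftX x0 * u + shiftX x0 * shiftY y0 * v + shiftY y0 * shiftY y0 * w)"
proof -
  obtain u v where p: "p = shiftX x0 * u + shiftY y0 * v" using eval2_decomp[of p x0 y0] assms by auto
  obtain u1 v1 where u: "u = constA (eval2 x0 y0 u) + shiftX x0 * u1 + shiftY y0 * v1"
    using eval2_decomp by blast
  obtain u2 v2 where v: "v = constA (eval2 x0 y0 v) + shiftX x0 * u2 + shiftY y0 * v2"
    using eval2_decomp by blast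
  have "p = constA (eval2 x0 y0 u) * shiftX x0 + constA (eval2 x0 y0 v) * shiftY y0 +
     (shiftX x0 * shiftX x0 * u1 + shiftX x0 * shiftY y0 * (v1 + u2) + shiftY y0 * shiftY y0 * v2)"
    unfolding p by (subst u, subst v) (simp add: algebra_simps)
  then show ?thesis by blast
qed

definition partialX :: "'k::field \<Rightarrow> 'k \<Rightarrow> 'k poly poly \<Rightarrow> 'k" where
  "partialX x0 y0 p = poly (pderiv (poly p [:y0:])) x0"
definition partialY :: "'k::field \<Rightarrow> 'k \<Rightarrow> 'k poly poly \<Rightarrow> 'k" where
  "partialY x0 y0 p = poly (poly (pderiv p) [:y0:]) x0"

lemma partial_add:
  "partialX x0 y0 (p + q) = partialX x0 y0 p + partialX x0 y0 q"
  "partialY x0 y0 (p + q) = partialY x0 y0 p + partialY x0 y0 q"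
  by (simp_all add: partialX_def partialY_def pderiv_add)

lemma partial_mult:
  "partialX x0 y0 (p * q) = partialX x0 y0 p * eval2 x0 y0 q + eval2 x0 y0 p * partialX x0 y0 q"
  "partialY x0 y0 (p * q) = partialY x0 y0 p * eval2 x0 y0 q + eval2 x0 y0 p * partialY x0 y0 q"
  by (simp_all add: partialX_def partialY_def eval2_def pderiv_mult)

lemma partial_base [simp]:
  "partialX x0 y0 (constA c) = 0" "partialX x0 y0 (shiftX x0) = 1" "partialX x0 y0 (shiftY y0) = 0"
  "partialY x0 y0 (constA c) = 0" "partialY x0 y0 (shiftX x0) = 0" "partialY x0 y0 (shiftY y0) = 1"
  by (simp_all add: partialX_def partialY_def constA_def shiftX_def shiftY_def pderiv_pCons)

text \<open>The substitution \<open>x = x0 + s\<close>, \<open>y = y0 + s t\<close> of a chart of the blowup at \<open>(x0, y0)\<close>;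
  its values lie in \<open>k[s][t]\<close>.\<close>

definition blowup :: "'k::field \<Rightarrow> 'k \<Rightarrow> 'k poly poly \<Rightarrow> 'k poly poly" where
  "blowup x0 y0 p = map_poly (\<lambda>q. q \<circ>\<^sub>p [:x0, 1:]) p \<circ>\<^sub>p [:[:y0:], [:0, 1:]:]"

definition blowup_s :: "'k::field poly poly" where "blowup_s = [:[:0, 1:]:]"

lemma comm_ring_hom_shift: "comm_ring_hom (\<lambda>q::'k::field poly. q \<circ>\<^sub>p [:x0, 1:])"
  by unfold_locales (auto simp: pcompose_add pcompose_mult pcompose_1)

lemma blowup_simps [simp]:
  fixes p q :: "'k::field poly poly"
  shows "blowup x0 y0 (p + q) = blowup x0 y0 p + blowup x0 y0 q"
    and "blowup x0 y0 (p * q) = blowup x0 y0 p * blowup x0 y0 q"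
    and "blowup x0 y0 (constA c) = constA c"
    and "blowup x0 y0 0 = 0" and "blowup x0 y0 1 = 1"
    and "blowup x0 y0 (shiftX x0) = blowup_s"
    and "blowup x0 y0 (shiftY y0) = blowup_s * [:0, 1:]"
proof -
  interpret s: comm_ring_hom "\<lambda>q::'k poly. q \<circ>\<^sub>p [:x0, 1:]" by (rule comm_ring_hom_shift)
  interpret m: map_poly_comm_ring_hom "\<lambda>q::'k poly. q \<circ>\<^sub>p [:x0, 1:]" ..
  have "comm_semiring_hom (\<lambda>q::'k poly. q \<circ>\<^sub>p [:x0, 1:])" by unfold_locales
  note mp = comm_semiring_hom.map_poly_pCons_hom[OF this]
  show "blowup x0 y0 (p + q) = blowup x0 y0 p + blowup x0 y0 q"
    unfolding blowup_def m.hom_add by (rule pcompose_add)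
  show "blowup x0 y0 (p * q) = blowup x0 y0 p * blowup x0 y0 q"
    unfolding blowup_def m.hom_mult by (rule pcompose_mult)
  show "blowup x0 y0 (constA c) = constA c"
    unfolding blowup_def constA_def mp by (simp add: pcompose_pCons)
  show "blowup x0 y0 0 = 0" unfolding blowup_def by simp
  show "blowup x0 y0 1 = 1" unfolding blowup_def by (simp add: pcompose_1)
  show "blowup x0 y0 (shiftX x0) = blowup_s"
    unfolding blowup_def shiftX_def blowup_s_def mp by (simp add: pcompose_pCons)
  show "blowup x0 y0 (shiftY y0) = blowup_s * [:0, 1:]"
    unfolding blowup_def shiftY_def blowup_s_def mp by (simp add: pcompose_pCons)
qed

lemma blowup_power [simp]: "blowup x0 y0 (p ^ n) = blowup x0 y0 p ^ n"
  by (induction n) auto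

text \<open>Both substitutions are by polynomials of positive degree, and composition with such a
  polynomial is injective.\<close>

lemma blowup_eq_0_iff [simp]: "blowup x0 y0 p = 0 \<longleftrightarrow> p = 0"
proof
  assume "blowup x0 y0 p = 0"
  then have "map_poly (\<lambda>q. q \<circ>\<^sub>p [:x0, 1:]) p = 0"
    unfolding blowup_def by (rule pcompose_eq_0) simp
  then have "Polynomial.coeff p n \<circ>\<^sub>p [:x0, 1:] = 0" for n
    by (metis coeff_0 coeff_map_poly pcompose_0)
  then have "Polynomial.coeff p n = 0" for n
    using pcompose_eq_0[of "Polynomial.coeff p n" "[:x0, 1:]"] by simp
  then show "p = 0" by (intro poly_eqI) simp
qed simp

lemma prime_elem_blowup_s: "prime_elem (blowup_s :: 'k::field poly poly)"
proof -
  have "prime_elem [:0, 1 :: 'k:]"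
  proof (rule prime_elemI)
    fix p q :: "'k poly"
    have dvd: "[:0, 1:] dvd r \<longleftrightarrow> poly r 0 = 0" for r :: "'k poly"
      using poly_eq_0_iff_dvd[of r 0] by simp
    assume "[:0, 1:] dvd p * q"
    then show "[:0, 1:] dvd p \<or> [:0, 1:] dvd q" by (simp only: dvd poly_mult) simp
  qed (auto simp: is_unit_poly_iff)
  then show ?thesis unfolding blowup_s_def by (rule lift_prime_elem_poly)
qed

text \<open>Divisibility by a power of \<open>s\<close> is read off each coefficient in
  \<open>k[s]\<close>, and a nonzero coefficient bounds the exponent by its degree.\<close>

lemma blowup_s_power_not_dvd:
  fixes f :: "'k::field poly poly"
  assumes "f \<noteq> 0"
  shows "\<exists>n. \<not> blowup_s ^ n dvd f"
proof -
  obtain i where i: "Polynomial.coeff f i \<noteq> 0" using assms by (metis leading_coeff_0_iff)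
  let ?n = "Suc (degree (Polynomial.coeff f i))"
  have "\<not> blowup_s ^ ?n dvd f"
  proof
    have p: "blowup_s ^ m = [:[:0, 1 :: 'k:] ^ m:]" for m by (induction m) (simp_all add: blowup_s_def pCons_one)
    assume "blowup_s ^ ?n dvd f"
    then have "[:0, 1:] ^ ?n dvd Polynomial.coeff f i" unfolding p by (simp add: const_poly_dvd_iff)
    then have "degree ([:0, 1 :: 'k:] ^ ?n) \<le> degree (Polynomial.coeff f i)"
      using i by (rule dvd_imp_degree_le)
    then show False by (simp add: degree_power_eq)
  qed
  then show ?thesis by blast
qed

section \<open>Points on plane curves over an algebraically closed field\<close>

lemma alg_closed_root:
  fixes p :: "'k::field poly"
  assumes "alg_closed_type TYPE('k)" "degree p > 0"
  obtains z where "poly p z = 0"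
  using assms unfolding alg_closed_type_def by blast

text \<open>The polynomial \<open>t * q(t) - 1\<close> has positive degree, and a root
  \<open>z\<close> of it satisfies \<open>z * q(z) = 1\<close>.\<close>

lemma alg_closed_nonroot:
  fixes q :: "'k::field poly"
  assumes "alg_closed_type TYPE('k)" "q \<noteq> 0"
  obtains z where "poly q z \<noteq> 0"
proof -
  have "degree (pCons (- 1) q) > 0" using assms(2) by simp
  then obtain z where "poly (pCons (- 1) q) z = 0" using alg_closed_root assms(1) by blast
  then have "poly q z \<noteq> 0" by auto
  then show thesis by (rule that)
qed

definition evalX :: "'k::field \<Rightarrow> 'k poly poly \<Rightarrow> 'k poly" where
  "evalX x0 p = map_poly (\<lambda>q. poly q x0) p"

lemma evalX_pCons: "evalX x0 (pCons c p) = pCons (poly c x0) (evalX x0 p)"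
  unfolding evalX_def by (cases "c = 0 \<and> p = 0") (auto simp: map_poly_pCons)

lemma eval2_conv_evalX: "eval2 x0 y0 p = poly (evalX x0 p) y0"
  by (induction p) (simp_all add: evalX_pCons eval2_def, simp add: evalX_def)

text \<open>The inclusion of \<open>k[y]\<close> into \<open>(k[x])[y]\<close>.\<close>

definition constX :: "'k::field poly \<Rightarrow> 'k poly poly" where
  "constX q = map_poly (\<lambda>c. [:c:]) q"

lemma constX_pCons: "constX (pCons c q) = pCons [:c:] (constX q)"
  unfolding constX_def by (cases "c = 0 \<and> q = 0") (auto simp: map_poly_pCons)

lemma constX_0 [simp]: "constX 0 = 0"
  by (simp add: constX_def)

lemma evalX_decomp: "\<exists>u. p = constX (evalX x0 p) + shiftX x0 * u"
proof (induction p)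
  case 0
  then show ?case by (intro exI[of _ 0]) (simp add: evalX_def)
next
  case (pCons c p)
  then obtain u where u: "p = constX (evalX x0 p) + shiftX x0 * u" by blast
  have "poly (c - [:poly c x0:]) x0 = 0" by simp
  then obtain v where v: "c - [:poly c x0:] = [:- x0, 1:] * v" unfolding poly_eq_0_iff_dvd by (elim dvdE)
  then have c: "c = [:poly c x0:] + [:- x0, 1:] * v" by (metis add.commute diff_add_cancel)
  have "pCons c p = [:c:] + [:0, 1:] * p" by simp
  also have "\<dots> = [:[:poly c x0:] + [:- x0, 1:] * v:] + [:0, 1:] * (constX (evalX x0 p) + shiftX x0 * u)"
    by (subst c, subst u) (rule refl)
  also have "\<dots> = constX (evalX x0 (pCons c p)) + shiftX x0 * ([:v:] + [:0, 1:] * u)"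
    by (simp add: evalX_pCons constX_pCons shiftX_def algebra_simps)
  finally show ?case by blast
qed

lemma prime_elem_dvd_factor:
  fixes f :: "'a::idom"
  assumes "prime_elem f" "f = s * w" "\<not> s dvd 1"
  shows "f dvd s"
proof -
  have "w dvd 1"
    using Factorial_Ring.irreducibleD[OF prime_elem_imp_irreducible[OF assms(1)] assms(2)] assms(3) by blast
  then obtain v where "1 = w * v" by (elim dvdE)
  then have "s = f * v" unfolding assms(2) by (simp add: mult.assoc)
  then show ?thesis by simp
qed

lemma shiftX_not_unit: "\<not> shiftX x0 dvd 1"
  by (auto simp: shiftX_def is_unit_poly_iff)

text \<open>A Nullstellensatz for the curve \<open>f = 0\<close>. If \<open>f\<close> depends on
  \<open>x\<close> alone, it is an associate of some \<open>x - x0\<close>, and \<open>g\<close>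
  does not vanish identically on that line. Otherwise the eliminant of \<open>f\<close> and
  \<open>g\<close> tells which \<open>x0\<close> to avoid.\<close>

lemma exists_point_not_vanishing:
  fixes f g :: "'k::field poly poly"
  assumes alg: "alg_closed_type TYPE('k)" and f: "prime_elem f" and fg: "\<not> f dvd g"
  obtains x0 y0 where "eval2 x0 y0 f = 0" "eval2 x0 y0 g \<noteq> 0"
proof (cases "degree f = 0")
  case True
  then obtain c where c: "f = [:c:]" by (elim degree_eq_zeroE)
  have "c \<noteq> 0" using f c by auto
  have "degree c \<noteq> 0"
  proof
    assume "degree c = 0"
    then obtain d where "c = [:d:]" by (elim degree_eq_zeroE)
    then have "f dvd 1" using \<open>c \<noteq> 0\<close> c by (auto simp: is_unit_poly_iff)
    then show False using f unfolding prime_elem_def by blast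
  qed
  then obtain x0 where x0: "poly c x0 = 0" using alg_closed_root[OF alg] by blast
  then obtain w where w: "c = [:- x0, 1:] * w" unfolding poly_eq_0_iff_dvd by (elim dvdE)
  then have fw: "f = shiftX x0 * [:w:]" using c by (simp add: shiftX_def)
  have "evalX x0 g \<noteq> 0"
  proof
    assume "evalX x0 g = 0"
    then obtain u where u: "g = shiftX x0 * u" using evalX_decomp[of g x0] by auto
    have "f dvd shiftX x0" by (rule prime_elem_dvd_factor[OF f fw shiftX_not_unit])
    then show False using u fg by auto
  qed
  then obtain y0 where y0: "poly (evalX x0 g) y0 \<noteq> 0" using alg_closed_nonroot[OF alg] by blast
  have "eval2 x0 y0 f = 0" using x0 by (simp add: c eval2_def)
  then show thesis using that y0 by (simp add: eval2_conv_evalX)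
next
  case False
  then obtain r u v where r: "r \<noteq> 0" "[:r:] = u * f + v * g"
    using prime_poly_elimination[OF f _ fg] by blast
  let ?l = "Polynomial.lead_coeff f"
  \<comment> \<open>Nonvanishing of the leading coefficient keeps \<open>f(x0, y)\<close> of
    positive degree, so that it has a root \<open>y0\<close>; nonvanishing of
    \<open>r = u * f + v * g\<close> at \<open>x0\<close> then keeps \<open>g\<close> from vanishing
    there.\<close>
  have "r * ?l \<noteq> 0" using r f by auto
  then obtain x0 where x0: "poly (r * ?l) x0 \<noteq> 0" using alg_closed_nonroot[OF alg] by blast
  have "Polynomial.coeff (evalX x0 f) (degree f) \<noteq> 0"
    using x0 by (simp add: evalX_def coeff_map_poly)
  then have "degree (evalX x0 f) > 0" using False le_degree by fastforce
  then obtain y0 where y0: "poly (evalX x0 f) y0 = 0" using alg_closed_root[OF alg] by blast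
  have "eval2 x0 y0 [:r:] \<noteq> 0" using x0 by (simp add: eval2_def)
  then have "eval2 x0 y0 g \<noteq> 0" unfolding r(2) using y0 by (auto simp: eval2_conv_evalX[of _ _ f])
  then show thesis using that y0 by (simp add: eval2_conv_evalX)
qed

section \<open>The exceptional divisor of the affine modification\<close>

lemma constA_hom: "inj_idom_hom (constA :: 'k::field \<Rightarrow> _)"
  by unfold_locales auto

text \<open>The form in which the quotient hypotheses enter. The last two assumptions say that
  \<open>A/(a, b)\<close> is \<open>k\<close>, so \<open>(a, b)\<close> is the ideal of a rational
  point of the plane.\<close>

locale affine_modification =
  fixes a b :: "'k::field poly poly"
  assumes prime_a: "prime_elem a" and not_dvd: "\<not> a dvd b"
    and decomp: "\<exists>c u v. z = constA c + u * a + v * b"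
    and proper: "u * a + v * b \<noteq> 1"
begin

definition "T = to_fract b / to_fract a"
definition "evT F = poly (map_poly to_fract F) T"

abbreviation "B \<equiv> B_set a b"

lemma a_nonzero [simp]: "a \<noteq> 0" using prime_a by auto

lemma a_T: "to_fract a * T = to_fract b"
  by (simp add: T_def)

lemma evT_simps [simp]:
  "evT (F + G) = evT F + evT G" "evT (F - G) = evT F - evT G" "evT (F * G) = evT F * evT G"
  "evT (- F) = - evT F" "evT 0 = 0" "evT 1 = 1" "evT (pCons c F) = to_fract c + T * evT F"
  "evT (Polynomial.smult c F) = to_fract c * evT F"
  "evT (Polynomial.monom c n) = to_fract c * T ^ n"
proof -
  interpret m: map_poly_inj_idom_hom "to_fract :: 'k poly poly \<Rightarrow> _" ..
  show "evT (F + G) = evT F + evT G" unfolding evT_def m.hom_add by simp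
  show "evT (F - G) = evT F - evT G" unfolding evT_def m.hom_minus by simp
  show "evT (F * G) = evT F * evT G" unfolding evT_def m.hom_mult by simp
  show "evT (- F) = - evT F" unfolding evT_def m.hom_uminus by simp
  show "evT 0 = 0" "evT 1 = 1" by (simp_all add: evT_def)
  show "evT (pCons c F) = to_fract c + T * evT F"
    by (simp add: evT_def to_fract_hom.map_poly_pCons_hom)
  show "evT (Polynomial.smult c F) = to_fract c * evT F"
    by (simp add: evT_def to_fract_hom.map_poly_hom_smult)
  show "evT (Polynomial.monom c n) = to_fract c * T ^ n"
    by (simp add: evT_def poly_monom)
qed

lemma evT_altdef:
  assumes "degree F \<le> n"
  shows "evT F = (\<Sum>i\<le>n. to_fract (Polynomial.coeff F i) * T ^ i)"
proof -
  have "evT F = (\<Sum>i\<le>degree F. to_fract (Polynomial.coeff F i) * T ^ i)"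
    unfolding evT_def by (simp add: poly_altdef)
  also have "\<dots> = (\<Sum>i\<le>n. to_fract (Polynomial.coeff F i) * T ^ i)"
    using assms by (intro sum.mono_neutral_left) (auto simp: coeff_eq_0)
  finally show ?thesis .
qed

lemma B_eq_range: "B = range evT"
proof
  show "B \<subseteq> range evT"
  proof
    fix g assume "g \<in> B"
    then obtain n c where g: "g = (\<Sum>i\<le>n. Fract (c i) 1 * Fract b a ^ i)"
      by (auto simp: B_set_def)
    have "evT (\<Sum>i\<le>m. Polynomial.monom (c i) i) = (\<Sum>i\<le>m. Fract (c i) 1 * Fract b a ^ i)" for m
      by (induction m) (simp_all add: to_fract_def[symmetric] Fract_conv_to_fract T_def)
    with g show "g \<in> range evT" by (metis rangeI)
  qed
  show "range evT \<subseteq> B"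
  proof clarify
    fix F
    have "evT F = (\<Sum>i\<le>degree F. Fract (Polynomial.coeff F i) 1 * Fract b a ^ i)"
      by (simp add: evT_altdef[OF order.refl] to_fract_def[symmetric] Fract_conv_to_fract T_def)
    then show "evT F \<in> B" unfolding B_set_def by blast
  qed
qed

sublocale BS: subring_set B
proof
  show "0 \<in> B" unfolding B_eq_range by (metis evT_simps(5) rangeI)
  show "1 \<in> B" unfolding B_eq_range by (metis evT_simps(6) rangeI)
  fix x y assume "x \<in> B" "y \<in> B"
  then obtain F G where "x = evT F" "y = evT G" unfolding B_eq_range by blast
  then show "x + y \<in> B" "x * y \<in> B" "- x \<in> B"
    unfolding B_eq_range by (metis evT_simps rangeI)+
qed

lemma to_fract_mem [simp]: "to_fract p \<in> B"
proof -
  have "evT [:p:] = to_fract p" by simp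
  then show ?thesis unfolding B_eq_range by (metis rangeI)
qed

lemma T_mem [simp]: "T \<in> B"
proof -
  have "evT [:0, 1:] = T" by simp
  then show ?thesis unfolding B_eq_range by (metis rangeI)
qed

lemma evT_mem [simp]: "evT F \<in> B"
  by (simp add: B_eq_range)

lemma const_frac_eq: "const_frac c = to_fract (constA c)"
  by (simp add: const_frac_def to_fract_def)

lemma const_frac_mem [simp]: "const_frac c \<in> B"
  by (simp add: const_frac_eq)

lemma power_T: "i \<le> n \<Longrightarrow> to_fract a ^ n * T ^ i = to_fract (b ^ i * a ^ (n - i))"
proof -
  assume "i \<le> n"
  then have "to_fract a ^ n = to_fract a ^ (n - i) * to_fract a ^ i"
    by (simp flip: power_add)
  then show ?thesis
    by (simp add: a_T[symmetric] power_mult_distrib to_fract_hom.hom_power)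
qed

text \<open>Multiplication by \<open>a^n\<close> homogenizes: the result is a form of degree
  \<open>n\<close> in \<open>a\<close> and \<open>b\<close>, and this degree later gives its order
  of vanishing on the blowup.\<close>

lemma evT_clear_denominator:
  assumes "degree F \<le> n"
  shows "to_fract a ^ n * evT F = to_fract (\<Sum>i\<le>n. Polynomial.coeff F i * (b ^ i * a ^ (n - i)))"
proof -
  have "to_fract a ^ n * evT F = (\<Sum>i\<le>n. to_fract (Polynomial.coeff F i) * (to_fract a ^ n * T ^ i))"
    by (simp add: evT_altdef[OF assms] sum_distrib_left mult.left_commute)
  also have "\<dots> = (\<Sum>i\<le>n. to_fract (Polynomial.coeff F i * (b ^ i * a ^ (n - i))))"
    by (intro sum.cong refl) (simp add: power_T)
  finally show ?thesis by simp
qed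

lemma B_clear_denominator: "g \<in> B \<Longrightarrow> \<exists>N p. to_fract a ^ N * g = to_fract p"
  using evT_clear_denominator[OF order.refl] unfolding B_eq_range by blast

definition "I = {u * a + v * b |u v. True}"

lemma I_I: "u * a + v * b \<in> I" unfolding I_def by blast

lemma I_add: "x \<in> I \<Longrightarrow> y \<in> I \<Longrightarrow> x + y \<in> I"
proof -
  assume "x \<in> I" "y \<in> I"
  then obtain u v u' v' where "x = u * a + v * b" "y = u' * a + v' * b" unfolding I_def by blast
  then have "x + y = (u + u') * a + (v + v') * b" by (simp add: algebra_simps)
  then show ?thesis using I_I by metis
qed

lemma I_mult: "x \<in> I \<Longrightarrow> w * x \<in> I"
proof -
  assume "x \<in> I"
  then obtain u v where "x = u * a + v * b" unfolding I_def by blast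
  then have "w * x = (w * u) * a + (w * v) * b" by (simp add: algebra_simps)
  then show ?thesis using I_I by metis
qed

lemma a_I: "a \<in> I" using I_I[of 1 0] by simp
lemma b_I: "b \<in> I" using I_I[of 0 1] by simp

lemma I_diff: "x \<in> I \<Longrightarrow> y \<in> I \<Longrightarrow> x - y \<in> I"
  using I_add[of x "- y"] I_mult[of y "- 1"] by simp

lemma constA_I: "constA c \<in> I \<longleftrightarrow> c = 0"
proof
  assume "constA c \<in> I"
  show "c = 0"
  proof (rule ccontr)
    assume "c \<noteq> 0"
    then have "constA (1 / c) * constA c = 1" by (simp flip: constA_simps(4))
    then have "1 \<in> I" using I_mult[OF \<open>constA c \<in> I\<close>, of "constA (1 / c)"] by simp
    then show False using proper unfolding I_def by force
  qed
next
  assume "c = 0"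
  then show "constA c \<in> I" using I_I[of 0 0] by simp
qed

text \<open>Induction on the degree bound. In the homogenized relation every term but the leading
  one contains \<open>a\<close>, so \<open>a\<close> divides the leading coefficient times a power
  of \<open>b\<close>, hence the leading coefficient.\<close>

lemma evT_eq_0_coeffs:
  assumes "evT F = 0" "degree F \<le> n"
  shows "Polynomial.coeff F i \<in> I"
  using assms
proof (induction n arbitrary: F i)
  case 0
  then obtain c where "F = [:c:]" by (auto elim: degree_eq_zeroE)
  with 0 have "F = 0" by simp
  then show ?case using constA_I[of 0] by simp
next
  case (Suc n)
  let ?f = "Polynomial.coeff F (Suc n)"
  have "to_fract (\<Sum>i\<le>Suc n. Polynomial.coeff F i * (b ^ i * a ^ (Suc n - i))) = 0"
    unfolding evT_clear_denominator[OF Suc.prems(2), symmetric] Suc.prems(1) by simp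
  then have "(\<Sum>i\<le>Suc n. Polynomial.coeff F i * (b ^ i * a ^ (Suc n - i))) = 0"
    by (simp only: to_fract_eq_0_iff)
  then have "?f * b ^ Suc n = - (\<Sum>i\<le>n. Polynomial.coeff F i * (b ^ i * a ^ (Suc n - i)))"
    by (simp add: eq_neg_iff_add_eq_0 add.commute)
  moreover have "a dvd (\<Sum>i\<le>n. Polynomial.coeff F i * (b ^ i * a ^ (Suc n - i)))"
    by (intro dvd_sum dvd_mult) (auto simp: Suc_diff_le)
  ultimately have "a dvd ?f * b ^ Suc n" by (simp only: dvd_minus_iff)
  moreover have "\<not> a dvd b ^ Suc n" using prime_elem_dvd_power[OF prime_a] not_dvd by blast
  ultimately have "a dvd ?f" using prime_elem_dvd_multD[OF prime_a] by blast
  then obtain e where e: "?f = a * e" by (elim dvdE)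
  \<comment> \<open>As \<open>a * T = b\<close>, the leading term \<open>a * e * T^(n+1)\<close>
    equals \<open>e * b * T^n\<close>. This exchange lowers the degree and alters coefficients only
    by \<open>e * a\<close> and \<open>e * b\<close>, which lie in \<open>I\<close>.\<close>
  define G where "G = F - Polynomial.monom ?f (Suc n) + Polynomial.monom (e * b) n"
  have "evT G = 0"
    using Suc.prems(1) by (simp add: G_def e a_T[symmetric])
  moreover have "degree G \<le> n"
    using Suc.prems(2) by (intro degree_le) (auto simp: G_def le_antisym coeff_eq_0 not_less Suc_le_eq)
  ultimately have IH: "Polynomial.coeff G j \<in> I" for j by (rule Suc.IH)
  have "Polynomial.coeff F i = Polynomial.coeff G i +
      ((if i = Suc n then e * a else 0) - (if i = n then e * b else 0))"
    by (simp add: G_def e)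
  moreover have "(0 :: 'k poly poly) \<in> I" using I_I[of 0 0] by simp
  ultimately show ?case
    using IH[of i] I_mult[OF a_I, of e] I_mult[OF b_I, of e] by (simp add: I_add I_diff)
qed

section \<open>The quotient \<open>B/aB\<close> as the polynomial ring \<open>k[T]\<close>\<close>

definition "kT p = evT (map_poly constA p)"

lemma kT_simps [simp]:
  "kT (p + q) = kT p + kT q" "kT (p - q) = kT p - kT q" "kT (p * q) = kT p * kT q"
  "kT 0 = 0" "kT 1 = 1" "kT (pCons c p) = const_frac c + T * kT p"
proof -
  interpret c: inj_idom_hom "constA :: 'k \<Rightarrow> _" by (rule constA_hom)
  interpret m: map_poly_inj_idom_hom "constA :: 'k \<Rightarrow> _" ..
  have sh: "comm_semiring_hom (constA :: 'k \<Rightarrow> _)" by unfold_locales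
  show "kT (p + q) = kT p + kT q" unfolding kT_def m.hom_add by simp
  show "kT (p - q) = kT p - kT q" unfolding kT_def m.hom_minus by simp
  show "kT (p * q) = kT p * kT q" unfolding kT_def m.hom_mult by simp
  show "kT 0 = 0" "kT 1 = 1" by (simp_all add: kT_def)
  show "kT (pCons c p) = const_frac c + T * kT p"
    unfolding kT_def comm_semiring_hom.map_poly_pCons_hom[OF sh] by (simp add: const_frac_eq)
qed

lemma kT_mem [simp]: "kT p \<in> B"
  by (simp add: kT_def)

text \<open>Coefficients reduce to constants because \<open>A = k + (a, b)\<close> and
  \<open>b = a * T\<close> already lies in \<open>aB\<close>.\<close>

lemma B_mod_a:
  assumes "g \<in> B"
  shows "\<exists>p. \<exists>h\<in>B. g = kT p + to_fract a * h"
proof -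
  obtain F where "g = evT F" using assms unfolding B_eq_range by blast
  moreover have "\<exists>p. \<exists>h\<in>B. evT F = kT p + to_fract a * h" for F
  proof (induction F)
    case 0
    then show ?case by (intro exI[of _ 0] bexI[of _ 0]) (simp_all add: BS.zero_mem)
  next
    case (pCons c F)
    then obtain p h where ph: "h \<in> B" "evT F = kT p + to_fract a * h" by blast
    obtain e u v where e: "c = constA e + u * a + v * b" using decomp by blast
    have "evT (pCons c F) = kT (pCons e p) + to_fract a * (to_fract u + to_fract v * T + T * h)"
      by (simp add: ph e const_frac_eq a_T[symmetric] algebra_simps)
    moreover have "to_fract u + to_fract v * T + T * h \<in> B"
      using ph by (intro BS.add_mem BS.mult_mem) auto
    ultimately show ?case by blast
  qed
  ultimately show ?thesis by blast
qed

text \<open>With \<open>h = H(T)\<close>, the polynomial \<open>p - a * H\<close> is a relation for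
  \<open>T\<close>, so \<open>evT_eq_0_coeffs\<close> puts the coefficients of \<open>p\<close> into
  \<open>I\<close>, where the only constant is 0.\<close>

lemma kT_dvd_a:
  assumes "h \<in> B" "kT p = to_fract a * h"
  shows "p = 0"
proof (rule poly_eqI)
  fix i
  interpret c: inj_idom_hom "constA :: 'k \<Rightarrow> _" by (rule constA_hom)
  obtain H where H: "h = evT H" using assms unfolding B_eq_range by blast
  let ?F = "map_poly constA p - Polynomial.smult a H"
  have "evT ?F = 0" using assms by (simp add: kT_def H)
  then have "Polynomial.coeff ?F i \<in> I" by (rule evT_eq_0_coeffs[OF _ order.refl])
  then have "constA (Polynomial.coeff p i) - a * Polynomial.coeff H i \<in> I"
    by (simp add: coeff_map_poly)
  then have "(constA (Polynomial.coeff p i) - a * Polynomial.coeff H i) + Polynomial.coeff H i * a \<in> I"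
    by (intro I_add I_mult a_I)
  then have "constA (Polynomial.coeff p i) \<in> I" by (simp add: mult.commute)
  then show "Polynomial.coeff p i = Polynomial.coeff 0 i" by (simp add: constA_I)
qed

lemma prime_in_a: "BS.prime_in (to_fract a)"
  unfolding BS.prime_in_def
proof (intro conjI ballI impI)
  show "\<not> BS.dvd_in (to_fract a) 1"
  proof
    assume "BS.dvd_in (to_fract a) 1"
    then obtain h where "h \<in> B" "kT 1 = to_fract a * h" by (auto simp: BS.dvd_in_def)
    then have "(1 :: 'k poly) = 0" by (rule kT_dvd_a)
    then show False by simp
  qed
  fix x y assume xy: "x \<in> B" "y \<in> B" and "BS.dvd_in (to_fract a) (x * y)"
  then obtain z where z: "z \<in> B" "x * y = to_fract a * z" by (auto simp: BS.dvd_in_def)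
  obtain p h where p: "h \<in> B" "x = kT p + to_fract a * h" using B_mod_a xy by blast
  obtain q h' where q: "h' \<in> B" "y = kT q + to_fract a * h'" using B_mod_a xy by blast
  have "kT (p * q) = to_fract a * (z - (h * y + kT p * h'))"
    using z unfolding p q by (simp add: algebra_simps)
  moreover have "z - (h * y + kT p * h') \<in> B"
    using z p q xy by (intro BS.diff_mem BS.add_mem BS.mult_mem) auto
  ultimately have "p * q = 0" using kT_dvd_a by blast
  then show "BS.dvd_in (to_fract a) x \<or> BS.dvd_in (to_fract a) y"
    using p q by (auto simp: BS.dvd_in_def)
qed auto

text \<open>\<open>x0\<close> and \<open>y0\<close> are the constants to which \<open>x\<close> and
  \<open>y\<close> reduce modulo \<open>(a, b)\<close>. Both shifts then lie in \<open>I\<close>, so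
  the value at the point of an element of \<open>I\<close> is a constant in \<open>I\<close>, hence
  zero.\<close>

lemma center_point:
  obtains x0 y0 where "shiftX x0 \<in> I" "shiftY y0 \<in> I" "eval2 x0 y0 a = 0" "eval2 x0 y0 b = 0"
proof -
  obtain x0 u v where x: "[:[:0, 1:]:] = constA x0 + u * a + v * b" using decomp by blast
  obtain y0 u' v' where y: "[:0, 1:] = constA y0 + u' * a + v' * b" using decomp by blast
  have "shiftX x0 = [:[:0, 1:]:] - constA x0" by (simp add: shiftX_def constA_def)
  then have X: "shiftX x0 \<in> I" using I_I[of u v] unfolding x by simp
  have "shiftY y0 = [:0, 1:] - constA y0" by (simp add: shiftY_def constA_def)
  then have Y: "shiftY y0 \<in> I" using I_I[of u' v'] unfolding y by simp
  have ev: "eval2 x0 y0 z = 0" if "z \<in> I" for z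
  proof -
    obtain u v where z: "z = constA (eval2 x0 y0 z) + shiftX x0 * u + shiftY y0 * v"
      using eval2_decomp by blast
    have "z - u * shiftX x0 - v * shiftY y0 \<in> I" using that X Y by (intro I_diff I_mult)
    also have "z - u * shiftX x0 - v * shiftY y0 = constA (eval2 x0 y0 z)"
      using z by (simp add: algebra_simps)
    finally show ?thesis by (simp add: constA_I)
  qed
  show thesis by (rule that[OF X Y ev[OF a_I] ev[OF b_I]])
qed

text \<open>On the blowup of the point \<open>(x0, y0)\<close> the pullback of \<open>a\<close> vanishes to order exactly one along
  the exceptional divisor \<open>s = 0\<close> and that of \<open>b\<close> to order at least one, so \<open>s\<close>-adic order bounds
  divisibility by powers of \<open>a\<close> inside \<open>B\<close>.\<close>

lemma a_power_not_dvd: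
  assumes "f \<noteq> 0"
  shows "\<exists>n. \<not> BS.dvd_in (to_fract a ^ n) (to_fract f)"
proof -
  obtain x0 y0 where P: "shiftX x0 \<in> I" "shiftY y0 \<in> I" "eval2 x0 y0 a = 0" "eval2 x0 y0 b = 0"
    by (rule center_point)
  define \<phi> where "\<phi> = blowup x0 y0"
  have \<phi>_simps: "\<phi> (p + q) = \<phi> p + \<phi> q" "\<phi> (p * q) = \<phi> p * \<phi> q" "\<phi> (p ^ n) = \<phi> p ^ n"
    "\<phi> 0 = 0" for p q n by (simp_all add: \<phi>_def)
  let ?s = "blowup_s :: 'k poly poly"
  note ps = prime_elem_blowup_s[where 'k = 'k]
  then have s0: "?s \<noteq> 0" by auto
  have \<phi>_decomp: "\<exists>w. \<phi> p = constA (eval2 x0 y0 p) + ?s * w" for p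
  proof -
    obtain u v where p: "p = constA (eval2 x0 y0 p) + shiftX x0 * u + shiftY y0 * v"
      using eval2_decomp by blast
    have "\<phi> p = constA (eval2 x0 y0 p) + ?s * (\<phi> u + [:0, 1:] * \<phi> v)"
      by (subst p) (simp add: \<phi>_def algebra_simps)
    then show ?thesis by blast
  qed
  obtain a' where a': "\<phi> a = ?s * a'" using \<phi>_decomp[of a] P by auto
  obtain b' where b': "\<phi> b = ?s * b'" using \<phi>_decomp[of b] P by auto
  have na: "\<not> ?s dvd a'"
  proof
    assume "?s dvd a'"
    then obtain c where c: "a' = ?s * c" by (elim dvdE)
    \<comment> \<open>If \<open>a\<close> vanished to order two, the pullback of every element of
      \<open>I\<close>, divided by \<open>s\<close>, would be a constant multiple of
      \<open>b'\<close> modulo \<open>s\<close>. For \<open>x - x0\<close> and \<open>y - y0\<close>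
      these quotients are \<open>1\<close> and \<open>t\<close>.\<close>
    have gen: "\<exists>d w. z = constA d * b' + ?s * w" if x: "x \<in> I" "\<phi> x = ?s * z" for x z
    proof -
      obtain u v where uv: "x = u * a + v * b" using x unfolding I_def by blast
      obtain w where w: "\<phi> v = constA (eval2 x0 y0 v) + ?s * w" using \<phi>_decomp by blast
      have "?s * z = ?s * (constA (eval2 x0 y0 v) * b' + ?s * (\<phi> u * c + w * b'))"
        using x(2) unfolding uv \<phi>_simps a' b' c w by (simp add: algebra_simps)
      then show ?thesis using s0 by (metis mult_left_cancel)
    qed
    have "\<phi> (shiftX x0) = ?s * 1" "\<phi> (shiftY y0) = ?s * [:0, 1:]" by (simp_all add: \<phi>_def)
    with gen P obtain d w d' w' where d: "1 = constA d * b' + ?s * w"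
      and d': "[:0, 1:] = constA d' * b' + ?s * w'" by metis
    \<comment> \<open>Eliminating \<open>b'\<close> gives \<open>d * t - d' = 0\<close> modulo
      \<open>s\<close>; the coefficient of \<open>t\<close> forces \<open>d = 0\<close>, and then
      \<open>s\<close> divides \<open>1\<close>.\<close>
    have "[:- [:d':], [:d:]:] = ?s * (constA d * w' - constA d' * w)"
    proof -
      have "[:- [:d':], [:d:]:] = constA d * [:0, 1:] - constA d' * 1" by (simp add: constA_def)
      also have "\<dots> = ?s * (constA d * w' - constA d' * w)"
        unfolding d d' by (simp add: algebra_simps)
      finally show ?thesis .
    qed
    then have "?s dvd [:- [:d':], [:d:]:]" by simp
    then have "[:0, 1:] dvd Polynomial.coeff [:- [:d':], [:d:]:] 1"
      unfolding blowup_s_def const_poly_dvd_iff by blast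
    then have "poly [:d:] 0 = 0" using poly_eq_0_iff_dvd[of "[:d:]" 0] by simp
    then have "d = 0" by simp
    with d have "?s dvd 1" by (metis constA_simps(1) add_0 dvd_triv_left mult_zero_left)
    then show False using ps by (simp add: prime_elem_def)
  qed
  have dvd: "?s ^ n dvd \<phi> f" if dv: "BS.dvd_in (to_fract a ^ n) (to_fract f)" for n
  proof -
    obtain h where h: "h \<in> B" "to_fract f = to_fract a ^ n * h"
      using dv by (auto simp: BS.dvd_in_def)
    obtain H where H: "h = evT H" using h unfolding B_eq_range by blast
    let ?M = "degree H"
    let ?Q = "\<Sum>i\<le>?M. Polynomial.coeff H i * (b ^ i * a ^ (?M - i))"
    have "to_fract (a ^ ?M * f) = to_fract (a ^ n * ?Q)"
      using evT_clear_denominator[of H ?M] h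
      by (simp add: H to_fract_hom.hom_power mult.left_commute del: to_fract_sum)
    then have "a ^ ?M * f = a ^ n * ?Q" by (simp only: to_fract_eq_iff)
    then have "\<phi> (a ^ ?M * f) = \<phi> (a ^ n * ?Q)" by (rule arg_cong)
    then have e: "\<phi> a ^ ?M * \<phi> f = \<phi> a ^ n * \<phi> ?Q" unfolding \<phi>_simps(2,3) .
    \<comment> \<open>\<open>?Q\<close> is a form of degree \<open>?M\<close> in \<open>a\<close>
      and \<open>b\<close>, whose pullbacks are divisible by \<open>s\<close>; the induction runs
      over partial sums with the degree \<open>m\<close> fixed. The factor \<open>s^?M\<close> of
      its pullback cancels against the one in \<open>\<phi> a ^ ?M\<close>, and the remaining
      \<open>a'\<close> is not divisible by \<open>s\<close>.\<close>
    have "?s ^ m dvd \<phi> (\<Sum>i\<le>l. Polynomial.coeff H i * (b ^ i * a ^ (m - i)))" if "l \<le> m" for l m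
      using that
    proof (induction l)
      case 0
      then show ?case by (simp add: \<phi>_simps a' power_mult_distrib)
    next
      case (Suc l)
      have "?s ^ m dvd \<phi> b ^ Suc l * \<phi> a ^ (m - Suc l)"
      proof -
        have "?s ^ m = ?s ^ Suc l * ?s ^ (m - Suc l)" using Suc.prems by (simp only: power_add[symmetric] le_add_diff_inverse)
        then show ?thesis unfolding a' b' power_mult_distrib
          by (metis dvd_triv_left mult_dvd_mono)
      qed
      then have "?s ^ m dvd \<phi> (Polynomial.coeff H (Suc l) * (b ^ Suc l * a ^ (m - Suc l)))"
        unfolding \<phi>_simps by (rule dvd_mult)
      with Suc show ?case by (simp only: sum.atMost_Suc \<phi>_simps(1)) simp
    qed
    from this[of ?M ?M] obtain w where w: "\<phi> ?Q = ?s ^ ?M * w"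
      unfolding dvd_def by blast
    have "?s ^ ?M * (a' ^ ?M * \<phi> f) = ?s ^ ?M * (?s ^ n * (a' ^ n * w))"
      using e unfolding w a' power_mult_distrib by (simp add: algebra_simps)
    then have "a' ^ ?M * \<phi> f = ?s ^ n * (a' ^ n * w)" using s0 by simp
    then have "?s ^ n dvd a' ^ ?M * \<phi> f" by simp
    moreover have "\<not> ?s dvd a' ^ ?M" using na prime_elem_dvd_power[OF ps] by blast
    ultimately show ?thesis using prime_power_dvd_cancel[OF ps] by blast
  qed
  obtain n where "\<not> ?s ^ n dvd \<phi> f" using blowup_s_power_not_dvd[of "\<phi> f"] assms by (auto simp: \<phi>_def)
  then show ?thesis using dvd by blast
qed

text \<open>A power of \<open>a\<close> dividing \<open>g\<close> also divides the polynomial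
  \<open>a^N * g\<close>, to which the bound applies; so there is a largest such power to split
  off.\<close>

lemma a_adic_decomp:
  assumes "g \<in> B" "g \<noteq> 0"
  shows "\<exists>n h. h \<in> B \<and> g = to_fract a ^ n * h \<and> \<not> BS.dvd_in (to_fract a) h"
proof -
  have "\<exists>n. \<not> BS.dvd_in (to_fract a ^ n) g"
  proof -
    obtain N p where p: "to_fract a ^ N * g = to_fract p" using B_clear_denominator assms by blast
    then have "p \<noteq> 0" using assms(2)
      by (metis a_nonzero mult_eq_0_iff power_not_zero to_fract_eq_0_iff)
    then obtain n where "\<not> BS.dvd_in (to_fract a ^ n) (to_fract p)" using a_power_not_dvd by blast
    then have "\<not> BS.dvd_in (to_fract a ^ n) g"
      unfolding BS.dvd_in_def p[symmetric]
      by (metis BS.mult_mem BS.power_mem mult.left_commute to_fract_mem)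
    then show ?thesis by blast
  qed
  then obtain n where n: "\<not> BS.dvd_in (to_fract a ^ n) g"
      "\<And>m. m < n \<Longrightarrow> BS.dvd_in (to_fract a ^ m) g"
    using exists_least_iff[of "\<lambda>n. \<not> BS.dvd_in (to_fract a ^ n) g"] by blast
  have "n \<noteq> 0" using n(1) assms by (intro notI) (simp add: BS.dvd_in_def)
  then obtain m where m: "n = Suc m" by (cases n) auto
  then obtain h where h: "h \<in> B" "g = to_fract a ^ m * h" using n(2)[of m] by (auto simp: BS.dvd_in_def)
  have "\<not> BS.dvd_in (to_fract a) h"
    using n(1) unfolding m h(2) BS.dvd_in_def by (auto simp: mult.assoc mult.left_commute)
  with h show ?thesis by blast
qed

subsection \<open>Factoriality and units\<close>

lemma to_fract_a_nonzero [simp]: "to_fract a \<noteq> 0" by simp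

text \<open>Descent from \<open>B[1/a]\<close> to \<open>B\<close>: \<open>a\<close> divides
  \<open>f * (a * z)\<close> but not \<open>f\<close>, so it divides \<open>a * z\<close>; the
  induction removes one factor \<open>a\<close> of the denominator at a time.\<close>

lemma mem_B_if_mult_mem:
  assumes f: "f \<in> B" "\<not> BS.dvd_in (to_fract a) f"
  shows "to_fract a ^ L * z \<in> B \<Longrightarrow> f * z \<in> B \<Longrightarrow> z \<in> B"
proof (induction L arbitrary: z)
  case (Suc L)
  have "to_fract a * (f * z) \<in> B" using Suc.prems BS.mult_mem[of "to_fract a" "f * z"] by simp
  then have faz: "f * (to_fract a * z) \<in> B" by (simp only: mult.left_commute)
  have "to_fract a ^ L * (to_fract a * z) \<in> B"
    using Suc.prems(1) by (simp only: power_Suc2 mult.assoc)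
  then have az: "to_fract a * z \<in> B" using faz by (rule Suc.IH)
  have "BS.dvd_in (to_fract a) (f * (to_fract a * z))"
    unfolding BS.dvd_in_def using Suc.prems(2) mult.left_commute by blast
  then have "BS.dvd_in (to_fract a) (to_fract a * z)"
    using f az prime_in_a unfolding BS.prime_in_def by blast
  then show ?case by (auto simp: BS.dvd_in_def)
qed simp

lemma to_fract_power_a: "to_fract a ^ n = to_fract (a ^ n)"
  by (simp add: to_fract_hom.hom_power)

lemma not_prime_dvd_a_power:
  assumes "prime_elem f" "\<not> a dvd f"
  shows "\<not> f dvd a ^ n"
proof
  assume "f dvd a ^ n"
  then have "f dvd a" using assms(1) by (rule prime_elem_dvd_power[rotated])
  then obtain w where w: "a = f * w" by (elim dvdE)
  then have "a dvd f * w" by simp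
  then have "a dvd w" using prime_elem_dvd_multD[OF prime_a] assms(2) by blast
  then obtain v where v: "w = a * v" by (elim dvdE)
  have "a * 1 = a * (f * v)" using w unfolding v by (simp add: mult.left_commute)
  then have "1 = f * v" by simp
  then have "f dvd 1" by (metis dvd_triv_left)
  then show False using assms(1) unfolding prime_elem_def by blast
qed

text \<open>In \<open>B[1/a]\<close> the elements \<open>f\<close> and \<open>f'\<close> are
  associates, so divisibility by \<open>f'\<close> can be tested there by divisibility of numerators
  by \<open>f\<close> in \<open>A\<close>; the descent lemma brings the quotient back into
  \<open>B\<close>.\<close>

lemma prime_in_strict_transform:
  assumes f: "prime_elem f" "\<not> a dvd f"
    and f': "f' \<in> B" "to_fract f = to_fract a ^ n * f'" "\<not> BS.dvd_in (to_fract a) f'"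
  shows "BS.prime_in f'"
  unfolding BS.prime_in_def
proof (intro conjI ballI impI)
  show "f' \<noteq> 0" using f(1) f'(2) by auto
  show "\<not> BS.dvd_in f' 1"
  proof
    assume "BS.dvd_in f' 1"
    then obtain z where z: "z \<in> B" "1 = f' * z" by (auto simp: BS.dvd_in_def)
    obtain N q where q: "to_fract a ^ N * z = to_fract q" using B_clear_denominator z by blast
    have "to_fract (f * q) = to_fract (a ^ (n + N))"
    proof -
      have "to_fract (f * q) = (to_fract a ^ n * f') * (to_fract a ^ N * z)"
        by (simp only: to_fract_mult f'(2) q)
      also have "\<dots> = to_fract a ^ (n + N) * (f' * z)" by (simp add: power_add algebra_simps)
      finally show ?thesis by (simp only: z(2)[symmetric] to_fract_power_a mult_1_right)
    qed
    then have "f * q = a ^ (n + N)" by (simp only: to_fract_eq_iff)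
    then have "f dvd a ^ (n + N)" by (metis dvd_triv_left)
    then show False using not_prime_dvd_a_power[OF f] by blast
  qed
  have main: "BS.dvd_in f' x" if x: "x \<in> B" "to_fract a ^ N * x = to_fract p" "f dvd p" for x N p
  proof -
    obtain p' where p': "p = f * p'" using x(3) by (elim dvdE)
    define z where "z = to_fract p' * to_fract a ^ n / to_fract a ^ N"
    have "to_fract a ^ N * x = to_fract a ^ N * (f' * z)"
      by (simp add: x(2) p' f'(2) z_def)
    then have xz: "x = f' * z" by simp
    have "to_fract a ^ N * z = to_fract (p' * a ^ n)" by (simp add: z_def to_fract_power_a)
    then have "to_fract a ^ N * z \<in> B" by simp
    then have "z \<in> B" using mem_B_if_mult_mem[OF f'(1,3)] xz x(1) by blast
    then show ?thesis using xz by (auto simp: BS.dvd_in_def)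
  qed
  fix x y assume xy: "x \<in> B" "y \<in> B" "BS.dvd_in f' (x * y)"
  then obtain z where z: "z \<in> B" "x * y = f' * z" by (auto simp: BS.dvd_in_def)
  obtain N p where p: "to_fract a ^ N * x = to_fract p" using B_clear_denominator xy by blast
  obtain M q where q: "to_fract a ^ M * y = to_fract q" using B_clear_denominator xy by blast
  obtain K r where r: "to_fract a ^ K * z = to_fract r" using B_clear_denominator z by blast
  have "to_fract (a ^ (n + K) * (p * q)) = to_fract (f * (r * a ^ (N + M)))"
  proof -
    have "to_fract (a ^ (n + K) * (p * q)) = to_fract a ^ (n + K) * ((to_fract a ^ N * x) * (to_fract a ^ M * y))"
      unfolding p q by (simp only: to_fract_mult to_fract_power_a)
    also have "\<dots> = to_fract a ^ (n + K) * to_fract a ^ (N + M) * (x * y)"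
      by (simp add: power_add algebra_simps)
    also have "\<dots> = (to_fract a ^ n * f') * (to_fract a ^ K * z) * to_fract a ^ (N + M)"
      by (simp add: z power_add algebra_simps)
    also have "\<dots> = to_fract f * to_fract r * to_fract (a ^ (N + M))"
      unfolding f'(2)[symmetric] r by (simp only: to_fract_power_a)
    finally show ?thesis by (simp only: to_fract_mult mult.assoc)
  qed
  then have "a ^ (n + K) * (p * q) = f * (r * a ^ (N + M))" by (simp only: to_fract_eq_iff)
  then have "f dvd a ^ (n + K) * (p * q)" by simp
  then have "f dvd p \<or> f dvd q"
    using prime_elem_dvd_multD[OF f(1)] not_prime_dvd_a_power[OF f] by blast
  then show "BS.dvd_in f' x \<or> BS.dvd_in f' y" using main[OF xy(1) p] main[OF xy(2) q] by blast
qed (rule f'(1))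

lemma unit_in_to_fract: "p dvd 1 \<Longrightarrow> BS.unit_in (to_fract p)"
proof -
  assume "p dvd 1"
  then obtain q where "1 = p * q" by (elim dvdE)
  then have "1 = to_fract p * to_fract q" by (metis to_fract_1 to_fract_mult)
  then show ?thesis by (auto simp: BS.unit_in_def BS.dvd_in_def)
qed

lemma prime_prod_to_fract_prime:
  assumes f: "prime_elem f"
  shows "BS.prime_prod (to_fract f)"
proof (cases "a dvd f")
  case True
  then obtain w where w: "f = w * a" by (metis dvdE mult.commute)
  have "\<not> a dvd 1" using prime_a unfolding prime_elem_def by blast
  moreover have "Factorial_Ring.irreducible f" using f by (rule prime_elem_imp_irreducible)
  ultimately have "w dvd 1" using w Factorial_Ring.irreducibleD by blast
  then show ?thesis unfolding w to_fract_mult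
    by (intro BS.prime_prod_unit_mult BS.prime_prod_prime prime_in_a unit_in_to_fract)
next
  case False
  have "to_fract f \<noteq> 0" using f by auto
  then obtain n h where h: "h \<in> B" "to_fract f = to_fract a ^ n * h" "\<not> BS.dvd_in (to_fract a) h"
    using a_adic_decomp[OF to_fract_mem] by blast
  have "BS.prime_in h" by (rule prime_in_strict_transform[OF f False h])
  then show ?thesis unfolding h(2)
    by (intro BS.prime_prod_mult BS.prime_prod_power BS.prime_prod_prime prime_in_a)
qed

lemma prime_prod_to_fract:
  assumes "p \<noteq> 0"
  shows "BS.prime_prod (to_fract p)"
proof (cases "p dvd 1")
  case True
  then show ?thesis using unit_in_to_fract BS.prime_prod.unit by blast
next
  case False
  then obtain F where "mset_factors F p" using assms mset_factors_exist by blast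
  then have F: "\<And>f. f \<in># F \<Longrightarrow> prime_elem f" "p = prod_mset F"
    by (auto simp: mset_factors_def)
  from F(1) have "BS.prime_prod (to_fract (prod_mset F))"
  proof (induction F)
    case empty
    then show ?case using unit_in_to_fract[of 1] BS.prime_prod.unit by simp
  next
    case (add f F)
    then have "BS.prime_prod (to_fract f)" "BS.prime_prod (to_fract (prod_mset F))"
      using prime_prod_to_fract_prime by auto
    then show ?case using BS.prime_prod_mult by simp
  qed
  then show ?thesis using F(2) by simp
qed

lemma prime_prod_B:
  assumes "g \<in> B" "g \<noteq> 0"
  shows "BS.prime_prod g"
proof -
  obtain N p where p: "to_fract a ^ N * g = to_fract p" using B_clear_denominator assms by blast
  moreover have "p \<noteq> 0" using p assms(2) by auto
  ultimately have "BS.prime_prod (to_fract a ^ N * g)" using prime_prod_to_fract by simp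
  then show ?thesis using BS.prime_prod_cancel_power prime_in_a assms(1) by blast
qed

lemma factorial_domain_B: "factorial_domain (B_ring a b)"
  unfolding B_ring_def by (rule BS.factorial_domain_ring_ofI) (rule prime_prod_B)

lemma unit_in_const_frac: "c \<noteq> 0 \<Longrightarrow> BS.unit_in (const_frac c)"
  unfolding const_frac_eq by (rule unit_in_to_fract) (auto simp: constA_def is_unit_poly_iff)

text \<open>When \<open>u * v = 1\<close>, the numerators multiply to a power of \<open>a\<close>,
  so primality of \<open>a\<close> in \<open>A\<close> makes \<open>u\<close> a constant times a
  possibly negative power of \<open>a\<close>; a nonzero exponent would make \<open>a\<close> divide
  a unit of \<open>B\<close>.\<close>

lemma Units_B: "Units (B_ring a b) = const_frac ` {c. c \<noteq> 0}"
proof -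
  have "BS.unit_in u \<longleftrightarrow> u \<in> const_frac ` {c. c \<noteq> 0}" for u
  proof
    assume u: "BS.unit_in u"
    then obtain v where v: "u \<in> B" "v \<in> B" "1 = u * v" by (auto simp: BS.unit_in_def BS.dvd_in_def)
    obtain N p where p: "to_fract a ^ N * u = to_fract p" using B_clear_denominator v by blast
    obtain M q where q: "to_fract a ^ M * v = to_fract q" using B_clear_denominator v by blast
    have "to_fract (p * q) = (to_fract a ^ N * u) * (to_fract a ^ M * v)"
      unfolding p q by (rule to_fract_mult)
    also have "\<dots> = to_fract a ^ (N + M) * (u * v)" by (simp add: power_add algebra_simps)
    finally have "to_fract (p * q) = to_fract (a ^ (N + M))"
      unfolding v(3)[symmetric] by (simp only: to_fract_power_a mult_1_right)
    then have "p * q = a ^ (N + M)" by (simp only: to_fract_eq_iff)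
    from prime_elem_power_eqD[OF prime_a this]
    obtain j e where e: "e dvd 1" "p = e * a ^ j" by blast
    from is_unit_constA[OF e(1)] obtain c where c: "c \<noteq> 0" "e = constA c" by blast
    have eq: "to_fract a ^ N * u = const_frac c * to_fract a ^ j"
      unfolding p const_frac_eq e(2) c(2) by (simp add: to_fract_power_a)
    have na: "\<not> BS.dvd_in (to_fract a) w" if uw: "BS.unit_in w" for w
    proof
      assume "BS.dvd_in (to_fract a) w"
      then obtain z w' where "z \<in> B" "w' \<in> B" "w = to_fract a * z" "1 = w * w'"
        using uw unfolding BS.unit_in_def BS.dvd_in_def by blast
      then have "BS.dvd_in (to_fract a) 1"
        unfolding BS.dvd_in_def by (metis BS.mult_mem mult.assoc)
      then show False using prime_in_a by (simp add: BS.prime_in_def)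
    qed
    consider "N = j" | d where "j = N + Suc d" | d where "N = j + Suc d"
      using less_iff_Suc_add by (metis add_Suc_right linorder_neqE_nat)
    then have "u = const_frac c"
    proof cases
      case 1
      then show ?thesis using eq by (simp add: mult.commute)
    next
      case 2
      have "to_fract a ^ N * u = to_fract a ^ N * (to_fract a * (const_frac c * to_fract a ^ d))"
        unfolding eq 2 power_add power_Suc by (simp add: algebra_simps)
      then have "u = to_fract a * (const_frac c * to_fract a ^ d)" by simp
      moreover have "const_frac c * to_fract a ^ d \<in> B" by (intro BS.mult_mem BS.power_mem) auto
      ultimately have "BS.dvd_in (to_fract a) u" by (auto simp: BS.dvd_in_def)
      then show ?thesis using na u by blast
    next
      case 3
      have "to_fract a ^ j * const_frac c = to_fract a ^ j * (to_fract a * (to_fract a ^ d * u))"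
        using eq unfolding 3 power_add power_Suc by (simp add: algebra_simps)
      then have "const_frac c = to_fract a * (to_fract a ^ d * u)" by simp
      moreover have "to_fract a ^ d * u \<in> B" using v by (intro BS.mult_mem BS.power_mem) auto
      ultimately have "BS.dvd_in (to_fract a) (const_frac c)" by (auto simp: BS.dvd_in_def)
      then show ?thesis using na unit_in_const_frac c by blast
    qed
    then show "u \<in> const_frac ` {c. c \<noteq> 0}" using c by blast
  qed (auto simp: unit_in_const_frac)
  then show ?thesis unfolding B_ring_def BS.Units_ring_of by blast
qed

subsection \<open>Prime ideals over an algebraically closed field\<close>

abbreviation "R \<equiv> ring_of B"

lemma const_frac_simps [simp]:
  "const_frac 0 = (0 :: 'k poly poly fract)" "const_frac 1 = (1 :: 'k poly poly fract)"
  "const_frac (c + d) = (const_frac c + const_frac d :: 'k poly poly fract)"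
  "const_frac (c - d) = (const_frac c - const_frac d :: 'k poly poly fract)"
  "const_frac (- c) = (- const_frac c :: 'k poly poly fract)"
  "const_frac (c * d) = (const_frac c * const_frac d :: 'k poly poly fract)"
  "const_frac c = (0 :: 'k poly poly fract) \<longleftrightarrow> c = 0"
  by (simp_all add: const_frac_eq)

lemma const_frac_inverse: "c \<noteq> 0 \<Longrightarrow> const_frac (1 / c) * const_frac c = (1 :: 'k poly poly fract)"
  by (simp flip: const_frac_simps(6))

lemma const_frac_mem_ideal:
  assumes "ideal P R" "P \<noteq> B" "const_frac c \<in> P"
  shows "c = 0"
proof (rule ccontr)
  assume "c \<noteq> 0"
  then have "1 \<in> P"
    using BS.ideal_mult[OF assms(1) const_frac_mem assms(3), of "1 / c"] const_frac_inverse by simp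
  then show False using BS.ideal_one assms by blast
qed

lemma primeideal_unfold:
  assumes "primeideal P R"
  shows "ideal P R" "P \<noteq> B" "\<And>x y. x \<in> B \<Longrightarrow> y \<in> B \<Longrightarrow> x * y \<in> P \<Longrightarrow> x \<in> P \<or> y \<in> P"
  using assms unfolding BS.primeideal_ring_of_iff by blast+

lemma primeideal_power:
  assumes "primeideal P R" "x \<in> B" "y \<in> B" "x ^ n * y \<in> P" "x \<notin> P"
  shows "y \<in> P"
  using assms(4)
proof (induction n)
  case (Suc n)
  have "x * (x ^ n * y) \<in> P" using Suc.prems by (simp add: mult.assoc)
  then show ?case
    using primeideal_unfold(3)[OF assms(1), of x "x ^ n * y"] assms BS.mult_mem BS.power_mem Suc.IH by blast
qed simp

text \<open>Evaluation of \<open>k\<close>-polynomials at an element of \<open>B\<close>, used for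
  \<open>x\<close>, \<open>y\<close> and \<open>T\<close> alike.\<close>

definition evalC :: "'k poly poly fract \<Rightarrow> 'k poly \<Rightarrow> 'k poly poly fract" where
  "evalC \<tau> p = poly (map_poly const_frac p) \<tau>"

lemma evalC_simps [simp]:
  "evalC \<tau> (pCons c p) = const_frac c + \<tau> * evalC \<tau> p" "evalC \<tau> 0 = 0" "evalC \<tau> 1 = 1"
  "evalC \<tau> (p * q) = evalC \<tau> p * evalC \<tau> q"
proof -
  interpret c: inj_idom_hom "const_frac :: 'k \<Rightarrow> _" by unfold_locales (auto simp: const_frac_eq)
  interpret m: map_poly_inj_idom_hom "const_frac :: 'k \<Rightarrow> _" ..
  have sh: "comm_semiring_hom (const_frac :: 'k \<Rightarrow> 'k poly poly fract)" by unfold_locales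
  show "evalC \<tau> (pCons c p) = const_frac c + \<tau> * evalC \<tau> p"
    unfolding evalC_def comm_semiring_hom.map_poly_pCons_hom[OF sh] by simp
  show "evalC \<tau> 0 = 0" "evalC \<tau> 1 = 1" by (simp_all add: evalC_def)
  show "evalC \<tau> (p * q) = evalC \<tau> p * evalC \<tau> q" unfolding evalC_def m.hom_mult by simp
qed

lemma evalC_mem: "\<tau> \<in> B \<Longrightarrow> evalC \<tau> p \<in> B"
  by (induction p) (auto simp: BS.zero_mem intro!: BS.add_mem BS.mult_mem)

lemma evalC_T: "evalC T p = kT p"
  by (induction p) simp_all

lemma evalC_x: "evalC (to_fract [:[:0, 1:]:]) p = to_fract [:p:]"
proof (induction p)
  case (pCons c p)
  have "to_fract [:pCons c p:] = to_fract (constA c + [:[:0, 1:]:] * [:p:])" by (simp add: constA_def)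
  then show ?case using pCons by (simp only: evalC_simps const_frac_eq to_fract_add to_fract_mult)
qed simp

lemma evalC_y: "evalC (to_fract [:0, 1:]) p = to_fract (constX p)"
proof (induction p)
  case (pCons c p)
  have "to_fract (constX (pCons c p)) = to_fract (constA c + [:0, 1:] * constX p)"
    by (simp add: constA_def constX_pCons)
  then show ?case using pCons by (simp only: evalC_simps const_frac_eq to_fract_add to_fract_mult)
qed simp

text \<open>Split off a root of \<open>p\<close> and let primality of \<open>P\<close> choose
  between the linear factor and the quotient of smaller degree. In effect, what is algebraic over
  \<open>k\<close> modulo \<open>P\<close> is constant modulo \<open>P\<close>.\<close>

lemma primeideal_linear_factor:
  assumes alg: "alg_closed_type TYPE('k)" and P: "primeideal P R" and \<tau>: "\<tau> \<in> B"
    and p: "p \<noteq> 0" "evalC \<tau> p \<in> P"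
  shows "\<exists>c. \<tau> - const_frac c \<in> P"
  using p
proof (induction "degree p" arbitrary: p rule: less_induct)
  case less
  show ?case
  proof (cases "degree p = 0")
    case True
    then obtain c where c: "p = [:c:]" by (elim degree_eq_zeroE)
    then have "const_frac c \<in> P" using less.prems by simp
    then have "c = 0" using const_frac_mem_ideal primeideal_unfold[OF P] by blast
    then show ?thesis using less.prems c by simp
  next
    case False
    then obtain z where "poly p z = 0" using alg_closed_root[OF alg] by blast
    then obtain q where q: "p = [:- z, 1:] * q" unfolding poly_eq_0_iff_dvd by (elim dvdE)
    then have q0: "q \<noteq> 0" using less.prems by auto
    then have dq: "degree q < degree p" unfolding q by (subst degree_mult_eq) auto
    have "(\<tau> - const_frac z) * evalC \<tau> q \<in> P"
      using less.prems(2) unfolding q evalC_simps(4) by simp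
    then have "\<tau> - const_frac z \<in> P \<or> evalC \<tau> q \<in> P"
      using primeideal_unfold(3)[OF P, of "\<tau> - const_frac z" "evalC \<tau> q"] \<tau>
        BS.diff_mem[OF \<tau> const_frac_mem] evalC_mem by blast
    then show ?thesis using less.hyps[OF dq q0] by blast
  qed
qed

text \<open>Eliminating \<open>y\<close> from \<open>f\<close> and \<open>g\<close> puts a nonzero
  polynomial in \<open>x\<close> into \<open>P\<close>, hence some \<open>x - x0\<close>.
  Restricting to the line \<open>x = x0\<close> whichever of \<open>f\<close>, \<open>g\<close> is
  not divisible by \<open>x - x0\<close> gives a nonzero polynomial in \<open>y\<close> in
  \<open>P\<close>.\<close>

lemma primeideal_contains_point:
  assumes alg: "alg_closed_type TYPE('k)" and P: "primeideal P R"
    and f: "prime_elem f" "to_fract f \<in> P" and g: "\<not> f dvd g" "to_fract g \<in> P"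
  shows "\<exists>x0 y0. to_fract (shiftX x0) \<in> P \<and> to_fract (shiftY y0) \<in> P"
proof -
  note PI = primeideal_unfold(1)[OF P]
  have "\<exists>r. r \<noteq> 0 \<and> to_fract [:r:] \<in> P"
  proof (cases "degree f = 0")
    case True
    then obtain c where "f = [:c:]" by (elim degree_eq_zeroE)
    then show ?thesis using f by (intro exI[of _ c]) auto
  next
    case False
    then obtain r u v where r: "r \<noteq> 0" "[:r:] = u * f + v * g"
      using prime_poly_elimination[OF f(1) _ g(1)] by blast
    then have "to_fract [:r:] \<in> P"
      unfolding r(2) to_fract_add to_fract_mult
      by (intro BS.ideal_add[OF PI] BS.ideal_mult[OF PI] f g) auto
    with r show ?thesis by blast
  qed
  then obtain r where r: "r \<noteq> 0" "evalC (to_fract [:[:0, 1:]:]) r \<in> P" unfolding evalC_x by blast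
  obtain x0 where "to_fract [:[:0, 1:]:] - const_frac x0 \<in> P"
    using primeideal_linear_factor[OF alg P to_fract_mem r] by blast
  moreover have "shiftX x0 = [:[:0, 1:]:] - constA x0" by (simp add: shiftX_def constA_def)
  ultimately have X: "to_fract (shiftX x0) \<in> P" by (simp only: to_fract_diff const_frac_eq)
  \<comment> \<open>If \<open>x - x0\<close> divided both, the prime \<open>f\<close> would be
    associated to it and would divide \<open>g\<close>.\<close>
  have "\<not> shiftX x0 dvd f \<or> \<not> shiftX x0 dvd g"
  proof (rule ccontr)
    assume "\<not> (\<not> shiftX x0 dvd f \<or> \<not> shiftX x0 dvd g)"
    then obtain w where w: "f = shiftX x0 * w" and dg: "shiftX x0 dvd g"
      unfolding dvd_def by blast
    have "f dvd shiftX x0" by (rule prime_elem_dvd_factor[OF f(1) w shiftX_not_unit])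
    from dvd_trans[OF this dg] show False using g(1) by blast
  qed
  then obtain h where h: "\<not> shiftX x0 dvd h" "to_fract h \<in> P" using f(2) g(2) by metis
  obtain u where u: "h = constX (evalX x0 h) + shiftX x0 * u" using evalX_decomp by blast
  have q0: "evalX x0 h \<noteq> 0" using h(1) u by auto
  have "to_fract (constX (evalX x0 h)) = to_fract h - to_fract (shiftX x0) * to_fract u"
  proof -
    have "constX (evalX x0 h) = h - shiftX x0 * u" using u by (simp add: algebra_simps)
    then show ?thesis by (simp only: to_fract_diff to_fract_mult)
  qed
  also have "\<dots> \<in> P" using X h by (intro BS.ideal_diff[OF PI] BS.ideal_mult_right[OF PI]) auto
  finally have "evalC (to_fract [:0, 1:]) (evalX x0 h) \<in> P" unfolding evalC_y .
  from primeideal_linear_factor[OF alg P to_fract_mem q0 this]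
  obtain y0 where "to_fract [:0, 1:] - const_frac y0 \<in> P" by blast
  moreover have "shiftY y0 = [:0, 1:] - constA y0" by (simp add: shiftY_def constA_def)
  ultimately have "to_fract (shiftY y0) \<in> P" by (simp only: to_fract_diff const_frac_eq)
  with X show ?thesis by blast
qed

text \<open>This is \<open>B = k + P\<close>. For a proper ideal the quotient is then the field
  \<open>k\<close>, so maximality can be checked without quotient rings.\<close>

definition residual :: "'k poly poly fract set \<Rightarrow> bool" where
  "residual P \<longleftrightarrow> (\<forall>g\<in>B. \<exists>c. g - const_frac c \<in> P)"

lemma residualI:
  assumes P: "ideal P R" and A: "\<And>z. \<exists>c. to_fract z - const_frac c \<in> P" and t: "T - const_frac t \<in> P"
  shows "residual P"
  unfolding residual_def
proof
  fix g assume "g \<in> B"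
  then obtain F where "g = evT F" unfolding B_eq_range by blast
  moreover have "\<exists>c. evT F - const_frac c \<in> P" for F
  proof (induction F)
    case 0
    then show ?case using BS.ideal_zero[OF P] by (intro exI[of _ 0]) simp
  next
    case (pCons z F)
    then obtain c where c: "evT F - const_frac c \<in> P" by blast
    obtain d where d: "to_fract z - const_frac d \<in> P" using A by blast
    have "(to_fract z - const_frac d) + (T * (evT F - const_frac c) + (T - const_frac t) * const_frac c) \<in> P"
      using c d t by (intro BS.ideal_add[OF P] BS.ideal_mult[OF P] BS.ideal_mult_right[OF P]) auto
    also have "(to_fract z - const_frac d) + (T * (evT F - const_frac c) + (T - const_frac t) * const_frac c)
        = evT (pCons z F) - const_frac (d + t * c)"
      by (simp add: algebra_simps)
    finally show ?case by blast
  qed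
  ultimately show "\<exists>c. g - const_frac c \<in> P" by blast
qed

lemma residual_maximal:
  assumes "residual P" "ideal J R" "J \<noteq> B" "P \<subseteq> J" "ideal P R"
  shows "J = P"
proof (intro equalityI subsetI)
  fix g assume g: "g \<in> J"
  then obtain c where c: "g - const_frac c \<in> P"
    using assms BS.ideal_sub unfolding residual_def by blast
  then have "g - (g - const_frac c) \<in> J"
    using g assms(4) by (blast intro: BS.ideal_diff[OF assms(2)])
  then have "c = 0" using const_frac_mem_ideal[OF assms(2,3), of c] by simp
  then show "g \<in> P" using c by simp
qed (use assms in auto)

text \<open>An element of \<open>P\<close> outside \<open>aB\<close> is a nonzero polynomial in
  \<open>T\<close> modulo \<open>a\<close>, so \<open>T\<close> is constant modulo \<open>P\<close>.
  The elements of \<open>A\<close> are constant modulo \<open>P\<close> because \<open>P\<close>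
  contains \<open>a\<close> and \<open>b = a * T\<close>.\<close>

lemma residual_exceptional:
  assumes alg: "alg_closed_type TYPE('k)" and P: "primeideal P R" and aP: "to_fract a \<in> P"
    and g: "g \<in> P" "\<not> BS.dvd_in (to_fract a) g"
  shows "residual P \<and> (\<exists>c. T - const_frac c \<in> P)"
proof -
  note PI = primeideal_unfold(1)[OF P]
  have gB: "g \<in> B" using BS.ideal_sub[OF PI] g by blast
  then obtain p h where p: "h \<in> B" "g = kT p + to_fract a * h" using B_mod_a by blast
  have "p \<noteq> 0" using p g(2) by (auto simp: BS.dvd_in_def)
  moreover have "evalC T p \<in> P"
  proof -
    have "g - to_fract a * h \<in> P" using g p aP by (intro BS.ideal_diff[OF PI] BS.ideal_mult_right[OF PI]) auto
    then show ?thesis by (simp add: p evalC_T)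
  qed
  ultimately obtain c where c: "T - const_frac c \<in> P"
    using primeideal_linear_factor[OF alg P T_mem] by blast
  have "\<exists>c. to_fract z - const_frac c \<in> P" for z
  proof -
    obtain c u v where z: "z = constA c + u * a + v * b" using decomp by blast
    have "(to_fract u + to_fract v * T) * to_fract a \<in> P"
      using aP by (intro BS.ideal_mult[OF PI] BS.add_mem BS.mult_mem) auto
    also have "(to_fract u + to_fract v * T) * to_fract a = to_fract z - const_frac c"
      by (simp add: z const_frac_eq a_T[symmetric] algebra_simps)
    finally show ?thesis by blast
  qed
  then have "residual P" using c by (intro residualI[OF PI]) auto
  with c show ?thesis by blast
qed

lemma to_fract_minus_eval2:
  assumes P: "ideal P R" and XY: "to_fract (shiftX x0) \<in> P" "to_fract (shiftY y0) \<in> P"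
  shows "to_fract z - const_frac (eval2 x0 y0 z) \<in> P"
proof -
  obtain u v where "z = constA (eval2 x0 y0 z) + shiftX x0 * u + shiftY y0 * v"
    using eval2_decomp by blast
  from arg_cong[OF this, of to_fract]
  have "to_fract z = const_frac (eval2 x0 y0 z) +
      to_fract (shiftX x0) * to_fract u + to_fract (shiftY y0) * to_fract v"
    unfolding const_frac_eq to_fract_add to_fract_mult .
  then have "to_fract z - const_frac (eval2 x0 y0 z) =
      to_fract (shiftX x0) * to_fract u + to_fract (shiftY y0) * to_fract v"
    by (simp only: add.assoc add_diff_cancel_left')
  also have "\<dots> \<in> P" using XY by (intro BS.ideal_add[OF P] BS.ideal_mult_right[OF P]) auto
  finally show ?thesis .
qed

lemma eval2_a_nonzero:
  assumes P: "ideal P R" and XY: "to_fract (shiftX x0) \<in> P" "to_fract (shiftY y0) \<in> P"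
    and aP: "to_fract a \<notin> P"
  shows "eval2 x0 y0 a \<noteq> 0"
  using to_fract_minus_eval2[OF P XY, of a] aP by auto

lemma residual_point:
  assumes P: "ideal P R" and XY: "to_fract (shiftX x0) \<in> P" "to_fract (shiftY y0) \<in> P"
    and aP: "to_fract a \<notin> P"
  shows "residual P"
proof (rule residualI[OF P])
  show "\<exists>c. to_fract z - const_frac c \<in> P" for z using to_fract_minus_eval2[OF P XY] by blast
  let ?a = "eval2 x0 y0 a" and ?b = "eval2 x0 y0 b"
  have a0: "?a \<noteq> 0" using eval2_a_nonzero[OF assms] .
  \<comment> \<open>Off \<open>a = 0\<close> the value of \<open>T\<close> has to be
    \<open>b(x0, y0) / a(x0, y0)\<close>; since \<open>b = a * T\<close>, this combination is
    \<open>T\<close> minus that constant.\<close>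
  have "const_frac (1 / ?a) * ((to_fract b - const_frac ?b) - (to_fract a - const_frac ?a) * T) \<in> P"
    by (intro BS.ideal_mult[OF P] BS.ideal_mult_right[OF P] BS.ideal_diff[OF P] to_fract_minus_eval2[OF P XY]) auto
  also have "const_frac (1 / ?a) * ((to_fract b - const_frac ?b) - (to_fract a - const_frac ?a) * T)
      = (const_frac (1 / ?a) * const_frac ?a) * T - const_frac (1 / ?a * ?b)"
    unfolding a_T[symmetric] const_frac_simps(6) by (simp add: algebra_simps)
  also have "\<dots> = T - const_frac (1 / ?a * ?b)" using const_frac_inverse[OF a0] by simp
  finally show "T - const_frac (1 / ?a * ?b) \<in> P" .
qed

lemma primeideal_contains_prime:
  assumes P: "primeideal P R" and p: "p \<noteq> 0" "to_fract p \<in> P"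
  shows "\<exists>f. prime_elem f \<and> to_fract f \<in> P"
proof -
  have no1: "1 \<notin> P" using BS.ideal_one primeideal_unfold[OF P] by blast
  have "\<not> p dvd 1"
  proof
    assume "p dvd 1"
    then obtain q where "1 = p * q" by (elim dvdE)
    then have "1 = to_fract p * to_fract q" by (metis to_fract_1 to_fract_mult)
    then show False using BS.ideal_mult_right[OF primeideal_unfold(1)[OF P] to_fract_mem p(2), of q] no1 by simp
  qed
  then obtain F where "mset_factors F p" using p mset_factors_exist by blast
  then have F: "\<And>f. f \<in># F \<Longrightarrow> prime_elem f" "p = prod_mset F" by (auto simp: mset_factors_def)
  have "to_fract (prod_mset F) \<in> P" using p F by simp
  with F(1) show ?thesis
  proof (induction F)
    case empty
    then show ?case using no1 by simp
  next
    case (add f F)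
    then have "to_fract f \<in> P \<or> to_fract (prod_mset F) \<in> P"
      using primeideal_unfold(3)[OF P to_fract_mem to_fract_mem] by simp
    then show ?case using add by auto
  qed
qed

lemma mem_clear_denominator:
  assumes "ideal P R" "g \<in> P" "g \<noteq> 0"
  obtains N p where "to_fract a ^ N * g = to_fract p" "to_fract p \<in> P" "p \<noteq> 0"
proof -
  obtain N p where p: "to_fract a ^ N * g = to_fract p"
    using B_clear_denominator BS.ideal_sub[OF assms(1,2)] by blast
  moreover have "to_fract a ^ N * g \<in> P" using assms BS.power_mem by (intro BS.ideal_mult) auto
  moreover have "p \<noteq> 0" using p assms(3) by auto
  ultimately show thesis using that by simp
qed

text \<open>The source of the upper bound on the dimension. If \<open>a\<close> is in
  \<open>P\<close>, an element of \<open>P\<close> outside \<open>aB\<close> is needed: one outside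
  \<open>Q\<close> when \<open>a\<close> is in \<open>Q\<close>, otherwise an element of
  \<open>Q\<close> stripped of its powers of \<open>a\<close>. If \<open>a\<close> is not in
  \<open>P\<close>, a prime \<open>f\<close> in \<open>Q\<close> and the numerator of an element of
  \<open>P\<close> outside \<open>Q\<close> are coprime and fix a point.\<close>

lemma primeideal_chain_residual:
  assumes alg: "alg_closed_type TYPE('k)" and Q: "primeideal Q R" and P: "primeideal P R"
    and QP: "Q \<subset> P" and Q0: "q \<in> Q" "q \<noteq> 0"
  shows "residual P"
proof (cases "to_fract a \<in> P")
  case True
  have "\<exists>g\<in>P. \<not> BS.dvd_in (to_fract a) g"
  proof (cases "to_fract a \<in> Q")
    case True
    obtain g where g: "g \<in> P" "g \<notin> Q" using QP by blast
    have "\<not> BS.dvd_in (to_fract a) g"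
      using g True BS.ideal_mult_right[OF primeideal_unfold(1)[OF Q]] by (auto simp: BS.dvd_in_def)
    with g show ?thesis by blast
  next
    case False
    have "q \<in> B" using BS.ideal_sub[OF primeideal_unfold(1)[OF Q]] Q0 by blast
    then obtain n h where h: "h \<in> B" "q = to_fract a ^ n * h" "\<not> BS.dvd_in (to_fract a) h"
      using a_adic_decomp Q0 by blast
    then have "h \<in> Q" using primeideal_power[OF Q to_fract_mem] Q0 False by blast
    then show ?thesis using h QP by blast
  qed
  then show ?thesis using residual_exceptional[OF alg P True] by blast
next
  case False
  then have aQ: "to_fract a \<notin> Q" using QP by blast
  obtain N p where p: "to_fract p \<in> Q" "p \<noteq> 0"
    using mem_clear_denominator[OF primeideal_unfold(1)[OF Q] Q0] by blast
  from primeideal_contains_prime[OF Q p(2,1)]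
  obtain f where f: "prime_elem f" "to_fract f \<in> Q" by (elim exE conjE)
  obtain g where g: "g \<in> P" "g \<notin> Q" using QP by blast
  have g0: "g \<noteq> 0" using g BS.ideal_zero[OF primeideal_unfold(1)[OF Q]] by auto
  obtain M s where s: "to_fract a ^ M * g = to_fract s" "to_fract s \<in> P"
    by (rule mem_clear_denominator[OF primeideal_unfold(1)[OF P] g(1) g0])
  have fs: "\<not> f dvd s"
  proof
    assume "f dvd s"
    then obtain w where "s = f * w" by (elim dvdE)
    then have "to_fract a ^ M * g \<in> Q"
      using s f BS.ideal_mult_right[OF primeideal_unfold(1)[OF Q]] by simp
    then have "g \<in> Q"
      using primeideal_power[OF Q to_fract_mem BS.ideal_sub[OF primeideal_unfold(1)[OF P] g(1)]] aQ by metis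
    then show False using g by simp
  qed
  have "to_fract f \<in> P" using f(2) QP by auto
  from primeideal_contains_point[OF alg P f(1) this fs s(2)]
  obtain x0 y0 where "to_fract (shiftX x0) \<in> P" "to_fract (shiftY y0) \<in> P" by (elim exE conjE)
  from residual_point[OF primeideal_unfold(1)[OF P] this False] show ?thesis .
qed

subsection \<open>Cotangent spaces and dimension\<close>

lemma dvd_in_a_not_1: "\<not> BS.dvd_in (to_fract a) 1"
  using prime_in_a unfolding BS.prime_in_def by simp

lemma dvd_in_a_kT: "BS.dvd_in (to_fract a) (kT p) \<Longrightarrow> p = 0"
  using kT_dvd_a unfolding BS.dvd_in_def by blast

definition exc_ideal :: "'k poly poly fract set" where
  "exc_ideal = {g\<in>B. BS.dvd_in (to_fract a) g}"

lemma ideal_exc: "ideal exc_ideal R"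
  unfolding BS.ideal_ring_of_iff
proof (intro conjI ballI)
  show "exc_ideal \<subseteq> B" by (auto simp: exc_ideal_def)
  show "0 \<in> exc_ideal"
    unfolding exc_ideal_def BS.dvd_in_def using BS.zero_mem by (auto intro!: bexI[of _ 0])
  fix x y assume "x \<in> exc_ideal" "y \<in> exc_ideal"
  then obtain z w where "z \<in> B" "w \<in> B" "x = to_fract a * z" "y = to_fract a * w" "x \<in> B" "y \<in> B"
    by (auto simp: exc_ideal_def BS.dvd_in_def)
  then have "x + y = to_fract a * (z + w)" "z + w \<in> B" "x + y \<in> B"
    by (simp_all add: algebra_simps BS.add_mem)
  then show "x + y \<in> exc_ideal" unfolding exc_ideal_def BS.dvd_in_def by blast
next
  fix x s assume "x \<in> exc_ideal" "s \<in> B"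
  then obtain z where "z \<in> B" "x = to_fract a * z" "x \<in> B"
    by (auto simp: exc_ideal_def BS.dvd_in_def)
  then have "s * x = to_fract a * (s * z)" "s * z \<in> B" "s * x \<in> B"
    using \<open>s \<in> B\<close> by (simp_all add: mult.left_commute BS.mult_mem)
  then show "s * x \<in> exc_ideal" unfolding exc_ideal_def BS.dvd_in_def by blast
qed

lemma exc_ideal_proper: "exc_ideal \<noteq> B"
  using dvd_in_a_not_1 BS.one_mem unfolding exc_ideal_def by blast

lemma primeideal_exc: "primeideal exc_ideal R"
  unfolding BS.primeideal_ring_of_iff
  using ideal_exc exc_ideal_proper prime_in_a unfolding BS.prime_in_def exc_ideal_def by simp

text \<open>The ideal \<open>(a, T)\<close>, written as the preimage of \<open>(T)\<close> under the
  map from \<open>B\<close> to \<open>k[T]\<close>.\<close>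

definition exc_point :: "'k poly poly fract set" where
  "exc_point = {g\<in>B. \<exists>p. poly p 0 = 0 \<and> BS.dvd_in (to_fract a) (g - kT p)}"

lemma exc_pointI:
  "g = kT p + to_fract a * h \<Longrightarrow> h \<in> B \<Longrightarrow> poly p 0 = 0 \<Longrightarrow> g \<in> exc_point"
  unfolding exc_point_def BS.dvd_in_def by (auto intro!: BS.add_mem BS.mult_mem)

lemma exc_pointE:
  assumes "g \<in> exc_point"
  obtains p h where "g = kT p + to_fract a * h" "h \<in> B" "poly p 0 = 0"
proof -
  from assms obtain p h where "poly p 0 = 0" "h \<in> B" "g - kT p = to_fract a * h"
    unfolding exc_point_def BS.dvd_in_def by blast
  then show thesis by (intro that[of p h]) (simp_all add: algebra_simps)
qed

text \<open>The residue \<open>p\<close> in \<open>k[T]\<close> is unique by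
  \<open>kT_dvd_a\<close>, so any representation decides membership.\<close>

lemma exc_point_iff:
  assumes "g = kT p + to_fract a * h" "h \<in> B"
  shows "g \<in> exc_point \<longleftrightarrow> poly p 0 = 0"
proof
  assume "g \<in> exc_point"
  then obtain q h' where q: "g = kT q + to_fract a * h'" "h' \<in> B" "poly q 0 = 0" by (rule exc_pointE)
  have "kT (p - q) = to_fract a * (h' - h)" using assms(1) q(1) by (simp add: algebra_simps)
  then have "p - q = 0" using kT_dvd_a BS.diff_mem[OF q(2) assms(2)] by blast
  then show "poly p 0 = 0" using q(3) by simp
qed (use exc_pointI assms in blast)

lemma primeideal_exc_point: "primeideal exc_point R"
  unfolding BS.primeideal_ring_of_iff BS.ideal_ring_of_iff
proof (intro conjI ballI impI)
  show "exc_point \<subseteq> B" by (auto simp: exc_point_def)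
  show "0 \<in> exc_point" by (rule exc_pointI[of _ 0 0]) (simp_all add: BS.zero_mem)
  have "1 \<notin> exc_point" using exc_point_iff[of 1 1 0] by (simp add: BS.zero_mem)
  then show "exc_point \<noteq> B" using BS.one_mem by blast
next
  fix x y assume "x \<in> exc_point" "y \<in> exc_point"
  then obtain p h q h' where x: "x = kT p + to_fract a * h" "h \<in> B" "poly p 0 = 0"
    and y: "y = kT q + to_fract a * h'" "h' \<in> B" "poly q 0 = 0" by (elim exc_pointE)
  show "x + y \<in> exc_point"
    by (rule exc_pointI[of _ "p + q" "h + h'"]) (use x y in \<open>simp_all add: BS.add_mem algebra_simps\<close>)
next
  fix x y assume x: "x \<in> exc_point" and yB: "y \<in> B"
  obtain p h where p: "x = kT p + to_fract a * h" "h \<in> B" "poly p 0 = 0" using x by (rule exc_pointE)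
  obtain q h' where q: "h' \<in> B" "y = kT q + to_fract a * h'" using B_mod_a yB by blast
  have "kT q * h + h' * x \<in> B"
    using p q x unfolding exc_point_def by (intro BS.add_mem BS.mult_mem) auto
  then show "y * x \<in> exc_point"
    by (intro exc_pointI[of _ "q * p" "kT q * h + h' * x"]) (simp_all add: p q algebra_simps)
next
  fix x y assume xB: "x \<in> B" and yB: "y \<in> B" and xy: "x * y \<in> exc_point"
  obtain p h where p: "h \<in> B" "x = kT p + to_fract a * h" using B_mod_a xB by blast
  obtain q h' where q: "h' \<in> B" "y = kT q + to_fract a * h'" using B_mod_a yB by blast
  have "h * y + kT p * h' \<in> B" using p q yB by (intro BS.add_mem BS.mult_mem) auto
  moreover have "x * y = kT (p * q) + to_fract a * (h * y + kT p * h')"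
    by (simp add: p q algebra_simps)
  ultimately have "poly (p * q) 0 = 0" using exc_point_iff xy by blast
  then show "x \<in> exc_point \<or> y \<in> exc_point"
    using exc_point_iff[OF p(2,1)] exc_point_iff[OF q(2,1)] by simp
qed

lemma maximalideal_unfold:
  assumes "maximalideal m R"
  shows "primeideal m R" "\<And>J. ideal J R \<Longrightarrow> m \<subseteq> J \<Longrightarrow> J \<noteq> B \<Longrightarrow> J = m"
  using BS.R.maximalideal_prime[OF assms] assms unfolding BS.maximalideal_ring_of_iff by blast+

lemma T_in_exc_point: "T \<in> exc_point"
  by (rule exc_pointI[of _ "[:0, 1:]" 0]) (simp_all add: BS.zero_mem)

lemma exc_ideal_subset: "exc_ideal \<subset> exc_point"
proof -
  have "exc_ideal \<subseteq> exc_point"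
    unfolding exc_ideal_def BS.dvd_in_def by (auto intro!: exc_pointI[of _ 0])
  moreover have "T \<notin> exc_ideal"
    using dvd_in_a_kT[of "[:0, 1:]"] unfolding exc_ideal_def by auto
  ultimately show ?thesis using T_in_exc_point by blast
qed

text \<open>For an ideal \<open>K\<close> of \<open>A\<close>, this is the ideal generated by
  \<open>K\<close> in \<open>A[1/a]\<close>, contracted to \<open>B\<close>. It is used for the
  ideal of a point and for the polynomials vanishing to second order there.\<close>

lemma ideal_localized:
  assumes 0: "K 0" and add: "\<And>p q. K p \<Longrightarrow> K q \<Longrightarrow> K (p + q)" and mult: "\<And>p q. K p \<Longrightarrow> K (q * p)"
  shows "ideal {g\<in>B. \<exists>N p. to_fract a ^ N * g = to_fract p \<and> K p} R" (is "ideal ?J R")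
  unfolding BS.ideal_ring_of_iff
proof (intro conjI ballI)
  show "?J \<subseteq> B" by auto
  show "0 \<in> ?J" using BS.zero_mem 0 by (auto intro!: exI[of _ 0])
  fix g h assume "g \<in> ?J" "h \<in> ?J"
  then obtain N p M q where gh: "g \<in> B" "h \<in> B" "to_fract a ^ N * g = to_fract p"
    "to_fract a ^ M * h = to_fract q" "K p" "K q"
    by blast
  have "to_fract a ^ (N + M) * (g + h) =
      to_fract a ^ M * (to_fract a ^ N * g) + to_fract a ^ N * (to_fract a ^ M * h)"
    by (simp add: power_add algebra_simps)
  also have "\<dots> = to_fract (a ^ M * p + a ^ N * q)" unfolding gh by (simp add: to_fract_power_a)
  finally have "to_fract a ^ (N + M) * (g + h) = to_fract (a ^ M * p + a ^ N * q)" .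
  moreover have "K (a ^ M * p + a ^ N * q)" by (intro add mult gh)
  moreover have "g + h \<in> B" using gh by (intro BS.add_mem)
  ultimately show "g + h \<in> ?J" by blast
next
  fix g s assume g: "g \<in> ?J" and s: "s \<in> B"
  obtain N p where gp: "g \<in> B" "to_fract a ^ N * g = to_fract p" "K p" using g by blast
  from B_clear_denominator[OF s] obtain M q where q: "to_fract a ^ M * s = to_fract q" by blast
  have "to_fract a ^ (N + M) * (s * g) = (to_fract a ^ M * s) * (to_fract a ^ N * g)"
    by (simp add: power_add algebra_simps)
  also have "\<dots> = to_fract (q * p)" unfolding gp q by simp
  finally have "to_fract a ^ (N + M) * (s * g) = to_fract (q * p)" .
  moreover have "K (q * p)" by (intro mult gp)
  moreover have "s * g \<in> B" using gp s by (intro BS.mult_mem)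
  ultimately show "s * g \<in> ?J" by blast
qed

text \<open>If \<open>a\<close> is in \<open>m\<close>, then \<open>m\<close> is not inside
  \<open>aB\<close>, because \<open>aB\<close> lies strictly inside the proper ideal
  \<open>(a, T)\<close>. If \<open>a\<close> is not in \<open>m\<close>, then \<open>m\<close>
  contains a prime polynomial \<open>f\<close>, and a second polynomial in \<open>m\<close> not
  divisible by \<open>f\<close> determines the point.\<close>

lemma maximalideal_cases:
  assumes alg: "alg_closed_type TYPE('k)" and m: "maximalideal m R"
  shows "residual m \<and> (to_fract a \<in> m \<and> (\<exists>c. T - const_frac c \<in> m) \<or>
     to_fract a \<notin> m \<and> (\<exists>x0 y0. to_fract (shiftX x0) \<in> m \<and> to_fract (shiftY y0) \<in> m))"
proof (cases "to_fract a \<in> m")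
  case True
  note P = maximalideal_unfold(1)[OF m]
  have "\<exists>g\<in>m. \<not> BS.dvd_in (to_fract a) g"
  proof (rule ccontr)
    assume "\<not> ?thesis"
    then have sub: "m \<subseteq> exc_ideal"
      using BS.ideal_sub[OF primeideal_unfold(1)[OF P]] unfolding exc_ideal_def by blast
    have "exc_ideal = m" by (rule maximalideal_unfold(2)[OF m ideal_exc sub exc_ideal_proper])
    moreover have "exc_point = m"
      using maximalideal_unfold(2)[OF m, of exc_point] sub exc_ideal_subset
        primeideal_unfold[OF primeideal_exc_point] by blast
    ultimately show False using exc_ideal_subset by simp
  qed
  then show ?thesis using residual_exceptional[OF alg P True] True by blast
next
  case False
  note P = maximalideal_unfold(1)[OF m]
  note PI = primeideal_unfold(1)[OF P]
  have "\<exists>g\<in>m. g \<noteq> 0"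
  proof (rule ccontr)
    assume "\<not> ?thesis"
    then have "m \<subseteq> {0}" by blast
    then have sub: "m \<subseteq> exc_ideal" using BS.ideal_zero[OF ideal_exc] by blast
    have "exc_ideal = m" by (rule maximalideal_unfold(2)[OF m ideal_exc sub exc_ideal_proper])
    moreover have "to_fract a \<in> exc_ideal"
      unfolding exc_ideal_def BS.dvd_in_def using BS.one_mem by (auto intro!: bexI[of _ 1])
    ultimately show False using False by simp
  qed
  then obtain g where g: "g \<in> m" "g \<noteq> 0" by blast
  obtain N p where p: "to_fract p \<in> m" "p \<noteq> 0" by (rule mem_clear_denominator[OF PI g])
  from primeideal_contains_prime[OF P p(2,1)]
  obtain f where f: "prime_elem f" "to_fract f \<in> m" by (elim exE conjE)
  have "\<exists>x0 y0. to_fract (shiftX x0) \<in> m \<and> to_fract (shiftY y0) \<in> m"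
  proof (cases "\<exists>h. to_fract h \<in> m \<and> \<not> f dvd h")
    case True
    then obtain h where h: "to_fract h \<in> m" "\<not> f dvd h" by (elim exE conjE)
    show ?thesis by (rule primeideal_contains_point[OF alg P f h(2,1)])
  next
    case nex: False
    \<comment> \<open>Here all polynomials in \<open>m\<close> are multiples of \<open>f\<close>. A
      point with \<open>f = 0\<close> and \<open>a \<noteq> 0\<close> has an ideal \<open>n\<close>
      in \<open>B\<close> that contains \<open>m\<close>, and maximality gives
      \<open>n = m\<close>.\<close>
    have "\<not> f dvd a"
    proof
      assume "f dvd a"
      then obtain w where "a = f * w" by (elim dvdE)
      then have "to_fract a = to_fract f * to_fract w" by simp
      then show False using BS.ideal_mult_right[OF PI to_fract_mem f(2)] False by simp
    qed
    then obtain x0 y0 where xy: "eval2 x0 y0 f = 0" "eval2 x0 y0 a \<noteq> 0"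
      by (rule exists_point_not_vanishing[OF alg f(1)])
    define n where "n = {g\<in>B. \<exists>N p. to_fract a ^ N * g = to_fract p \<and> eval2 x0 y0 p = 0}"
    have n: "ideal n R" unfolding n_def by (rule ideal_localized) simp_all
    have "1 \<notin> n"
    proof
      assume "1 \<in> n"
      then obtain N p where "to_fract a ^ N * 1 = to_fract p" "eval2 x0 y0 p = 0"
        unfolding n_def by blast
      then have "a ^ N = p" "eval2 x0 y0 p = 0" by (simp_all add: to_fract_power_a)
      then show False using xy(2) by auto
    qed
    then have nB: "n \<noteq> B" using BS.one_mem by blast
    have "m \<subseteq> n"
    proof
      fix g assume g: "g \<in> m"
      then have gB: "g \<in> B" using BS.ideal_sub[OF PI] by simp
      then obtain N p where p: "to_fract a ^ N * g = to_fract p" using B_clear_denominator by blast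
      then have "to_fract p \<in> m"
        using BS.ideal_mult[OF PI BS.power_mem[OF to_fract_mem] g] by metis
      then have "f dvd p" using nex by metis
      then obtain w where "p = f * w" by (elim dvdE)
      then have "eval2 x0 y0 p = 0" using xy by simp
      then show "g \<in> n" unfolding n_def using p gB by blast
    qed
    then have nm: "n = m" using maximalideal_unfold(2)[OF m n] nB by blast
    have "to_fract z \<in> n" if "eval2 x0 y0 z = 0" for z
      unfolding n_def using that by (auto intro!: exI[of _ "0::nat"])
    then have "to_fract (shiftX x0) \<in> n" "to_fract (shiftY y0) \<in> n" by simp_all
    then show ?thesis unfolding nm by blast
  qed
  then obtain x0 y0 where XY: "to_fract (shiftX x0) \<in> m" "to_fract (shiftY y0) \<in> m"
    by (elim exE conjE)
  from residual_point[OF PI XY False] XY False show ?thesis by blast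
qed

lemma cotangent_dim_eq_2I:
  assumes m: "ideal m R" and pq: "p \<in> m" "q \<in> m"
    and span: "\<And>g. g \<in> m \<Longrightarrow> \<exists>c d. g - (const_frac c * p + const_frac d * q) \<in> ideal_square R m"
    and indep: "\<And>c d. const_frac c * p + const_frac d * q \<in> ideal_square R m \<Longrightarrow> c = 0 \<and> d = 0"
  shows "cotangent_dim_eq R (const_frac :: 'k \<Rightarrow> _) m 2"
proof -
  define f where "f i = (if i = 0 then p else q)" for i :: nat
  have two: "{..<2} = {0, 1 :: nat}" by auto
  have pqB: "p \<in> B" "q \<in> B" using BS.ideal_sub[OF m] pq by auto
  have fin: "finsum R (\<lambda>i. const_frac (c i) \<otimes>\<^bsub>R\<^esub> f i) {..<2} =
      const_frac (c 0) * p + const_frac (c 1) * q" for c :: "nat \<Rightarrow> 'k"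
  proof -
    have "finsum R (\<lambda>i. const_frac (c i) \<otimes>\<^bsub>R\<^esub> f i) {..<2} =
        (\<Sum>i<2. const_frac (c i) \<otimes>\<^bsub>R\<^esub> f i)"
      by (rule BS.finsum_ring_of) (use pqB in \<open>auto simp: f_def BS.mult_mem\<close>)
    then show ?thesis by (simp add: two f_def)
  qed
  show ?thesis
    unfolding cotangent_dim_eq_def
  proof (intro exI[of _ f] conjI allI impI ballI)
    show "f i \<in> m" for i by (simp add: f_def pq)
    fix g assume g: "g \<in> m"
    then obtain c d where cd: "g - (const_frac c * p + const_frac d * q) \<in> ideal_square R m"
      using span by blast
    have B: "g \<in> B" "const_frac c * p + const_frac d * q \<in> B"
      using g BS.ideal_sub[OF m] pqB by (auto intro!: BS.add_mem BS.mult_mem)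
    define e where "e i = (if i = 0 then c else d)" for i :: nat
    have "g \<ominus>\<^bsub>R\<^esub> finsum R (\<lambda>i. const_frac (e i) \<otimes>\<^bsub>R\<^esub> f i) {..<2} \<in> ideal_square R m"
      unfolding fin using cd BS.a_minus_ring_of[OF B] by (simp add: e_def)
    then show "\<exists>c. g \<ominus>\<^bsub>R\<^esub> finsum R (\<lambda>i. const_frac (c i) \<otimes>\<^bsub>R\<^esub> f i) {..<2} \<in> ideal_square R m"
      by blast
  next
    fix c :: "nat \<Rightarrow> 'k" and i :: nat
    assume "finsum R (\<lambda>i. const_frac (c i) \<otimes>\<^bsub>R\<^esub> f i) {..<2} \<in> ideal_square R m" "i < 2"
    then show "c i = 0" unfolding fin using indep[of "c 0" "c 1"] by (auto simp: less_2_cases_iff)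
  qed
qed

lemma cotangent_exceptional:
  assumes m: "maximalideal m R" and res: "residual m" and am: "to_fract a \<in> m" and tm: "T - const_frac t \<in> m"
  shows "cotangent_dim_eq R (const_frac :: 'k \<Rightarrow> _) m 2"
proof -
  note P = maximalideal_unfold(1)[OF m]
  note PI = primeideal_unfold(1)[OF P]
  have mB: "m \<subseteq> B" using BS.ideal_sub[OF PI] by blast
  have c0: "c = 0" if "const_frac c \<in> m" for c
    using const_frac_mem_ideal[OF PI primeideal_unfold(2)[OF P] that] .
  define \<alpha> where "\<alpha> = to_fract a"
  define \<tau> where "\<tau> = T - const_frac t"
  have mem: "\<alpha> \<in> m" "\<tau> \<in> m" "\<alpha> \<in> B" "\<tau> \<in> B" using am tm mB by (auto simp: \<alpha>_def \<tau>_def)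
  note sq = BS.ideal_ideal_square[OF mB]
  note prod = BS.mult_in_ideal_square[OF mB]
  \<comment> \<open>\<open>m\<close> is generated by \<open>a\<close> and \<open>T - t\<close>:
    modulo \<open>a\<close>, \<open>g\<close> is some \<open>p(T)\<close>, and dividing
    \<open>p\<close> by \<open>T - t\<close> leaves a constant in \<open>m\<close>, which is
    zero.\<close>
  have gen: "\<exists>u\<in>B. \<exists>v\<in>B. g = \<alpha> * u + \<tau> * v" if g: "g \<in> m" for g
  proof -
    obtain p h where p: "h \<in> B" "g = kT p + \<alpha> * h" using B_mod_a[of g] g mB unfolding \<alpha>_def by blast
    have "poly (p - [:poly p t:]) t = 0" by simp
    then obtain q where q: "p - [:poly p t:] = [:- t, 1:] * q" unfolding poly_eq_0_iff_dvd by (elim dvdE)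
    have "p = [:poly p t:] + [:- t, 1:] * q" using q by (metis add.commute diff_add_cancel)
    then have "kT p = kT ([:poly p t:] + [:- t, 1:] * q)" by simp
    also have "\<dots> = const_frac (poly p t) + \<tau> * kT q"
      by (simp only: kT_simps) (simp add: \<tau>_def)
    finally have kp: "kT p = const_frac (poly p t) + \<tau> * kT q" .
    have "g - \<alpha> * h - \<tau> * kT q \<in> m"
      using g p mem by (intro BS.ideal_diff[OF PI] BS.ideal_mult_right[OF PI]) auto
    then have "const_frac (poly p t) \<in> m" by (simp add: p(2) kp)
    then have "poly p t = 0" by (rule c0)
    then have "g = \<alpha> * h + \<tau> * kT q" by (simp add: p(2) kp)
    then show ?thesis using p(1) kT_mem by blast
  qed
  have \<tau>_not_dvd: "\<not> BS.dvd_in \<alpha> \<tau>"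
  proof
    assume "BS.dvd_in \<alpha> \<tau>"
    moreover have "\<tau> = kT [:- t, 1:]" by (simp add: \<tau>_def)
    ultimately show False using dvd_in_a_kT[of "[:- t, 1:]"] unfolding \<alpha>_def by simp
  qed
  have pa: "BS.dvd_in \<alpha> x \<or> BS.dvd_in \<alpha> y" if "x \<in> B" "y \<in> B" "BS.dvd_in \<alpha> (x * y)" for x y
    using prime_in_a that unfolding BS.prime_in_def \<alpha>_def by blast
  have \<alpha>0: "\<alpha> \<noteq> 0" by (simp add: \<alpha>_def)
  show ?thesis
  proof (rule cotangent_dim_eq_2I[OF PI mem(1,2)])
    fix g assume "g \<in> m"
    then obtain u v where uv: "u \<in> B" "v \<in> B" "g = \<alpha> * u + \<tau> * v" using gen by blast
    obtain c d where cd: "u - const_frac c \<in> m" "v - const_frac d \<in> m"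
      using res uv unfolding residual_def by blast
    have "\<alpha> * (u - const_frac c) + \<tau> * (v - const_frac d) \<in> ideal_square R m"
      using cd mem by (intro BS.ideal_add[OF sq] prod)
    also have "\<alpha> * (u - const_frac c) + \<tau> * (v - const_frac d) =
        g - (const_frac c * \<alpha> + const_frac d * \<tau>)"
      by (simp add: uv(3) algebra_simps)
    finally show "\<exists>c d. g - (const_frac c * \<alpha> + const_frac d * \<tau>) \<in> ideal_square R m" by blast
  next
    fix c d assume cd: "const_frac c * \<alpha> + const_frac d * \<tau> \<in> ideal_square R m"
    \<comment> \<open>\<open>J\<close> is \<open>\<alpha> m + \<tau>^2 B\<close>. It contains all
      products of two elements of \<open>m\<close>, and its form keeps the cofactor of
      \<open>\<alpha>\<close> inside \<open>m\<close>.\<close>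
    define J where "J = {\<alpha> * x + \<tau> * \<tau> * w |x w. x \<in> m \<and> w \<in> B}"
    have J: "ideal J R"
      unfolding BS.ideal_ring_of_iff
    proof (intro conjI ballI)
      show "J \<subseteq> B" using mem mB unfolding J_def by (auto intro!: BS.add_mem BS.mult_mem)
      have "0 = \<alpha> * 0 + \<tau> * \<tau> * 0" by simp
      then show "0 \<in> J" unfolding J_def using BS.ideal_zero[OF PI] BS.zero_mem by blast
      fix x y assume "x \<in> J" "y \<in> J"
      then obtain z w z' w' where zw: "z \<in> m" "w \<in> B" "z' \<in> m" "w' \<in> B"
        "x = \<alpha> * z + \<tau> * \<tau> * w" "y = \<alpha> * z' + \<tau> * \<tau> * w'" unfolding J_def by blast
      have "x + y = \<alpha> * (z + z') + \<tau> * \<tau> * (w + w')" by (simp add: zw algebra_simps)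
      then show "x + y \<in> J"
        unfolding J_def using BS.ideal_add[OF PI zw(1,3)] BS.add_mem[OF zw(2,4)] by blast
    next
      fix x s assume "x \<in> J" and s: "s \<in> B"
      then obtain z w where zw: "z \<in> m" "w \<in> B" "x = \<alpha> * z + \<tau> * \<tau> * w" unfolding J_def by blast
      have "s * x = \<alpha> * (s * z) + \<tau> * \<tau> * (s * w)" by (simp add: zw algebra_simps)
      then show "s * x \<in> J"
        unfolding J_def using BS.ideal_mult[OF PI s zw(1)] BS.mult_mem[OF s zw(2)] by blast
    qed
    have "ideal_square R m \<subseteq> J"
    proof (rule BS.ideal_square_subset[OF J])
      fix x y assume "x \<in> m" "y \<in> m"
      then obtain u v u' v' where uv: "u \<in> B" "v \<in> B" "u' \<in> B" "v' \<in> B"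
        "x = \<alpha> * u + \<tau> * v" "y = \<alpha> * u' + \<tau> * v'" using gen by metis
      have "x * y = \<alpha> * (\<alpha> * (u * u') + \<tau> * (u * v' + v * u')) + \<tau> * \<tau> * (v * v')"
        by (simp add: uv algebra_simps)
      moreover have "\<alpha> * (u * u') + \<tau> * (u * v' + v * u') \<in> m"
        using uv mem by (intro BS.ideal_add[OF PI] BS.ideal_mult_right[OF PI] BS.add_mem BS.mult_mem)
      moreover have "v * v' \<in> B" using uv BS.mult_mem by blast
      ultimately show "x * y \<in> J" unfolding J_def by blast
    qed
    then obtain x w where xw: "x \<in> m" "w \<in> B" "const_frac c * \<alpha> + const_frac d * \<tau> = \<alpha> * x + \<tau> * \<tau> * w"
      using cd unfolding J_def by blast
    have xB: "x \<in> B" using xw(1) mB by blast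
    \<comment> \<open>\<open>\<alpha>\<close> is prime and does not divide \<open>\<tau>\<close>, so
      it divides \<open>const_frac d - \<tau> * w\<close>; this places the constant \<open>d\<close>
      in \<open>m\<close>.\<close>
    have "\<tau> * (const_frac d - \<tau> * w) = \<alpha> * (x - const_frac c)" using xw(3) by (simp add: algebra_simps)
    then have "BS.dvd_in \<alpha> (\<tau> * (const_frac d - \<tau> * w))"
      unfolding BS.dvd_in_def using BS.diff_mem[OF xB const_frac_mem] by blast
    moreover have dB: "const_frac d - \<tau> * w \<in> B" using xw mem by (intro BS.diff_mem BS.mult_mem) auto
    ultimately have "BS.dvd_in \<alpha> (const_frac d - \<tau> * w)" using pa[OF mem(4) dB] \<tau>_not_dvd by blast
    then obtain z where z: "z \<in> B" "const_frac d - \<tau> * w = \<alpha> * z" unfolding BS.dvd_in_def by blast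
    have "const_frac d = \<alpha> * z + \<tau> * w" using z(2) by (simp add: algebra_simps)
    also have "\<dots> \<in> m" using z mem xw by (intro BS.ideal_add[OF PI] BS.ideal_mult_right[OF PI])
    finally have d: "d = 0" by (rule c0)
    \<comment> \<open>Now that \<open>d = 0\<close>, \<open>\<alpha>\<close> divides
      \<open>\<tau>^2 * w\<close>, hence \<open>w\<close>; cancelling \<open>\<alpha>\<close> places
      the constant \<open>c\<close> in \<open>m\<close>.\<close>
    have e: "\<tau> * (\<tau> * w) = \<alpha> * (const_frac c - x)" using xw(3) d by (simp add: algebra_simps)
    then have "BS.dvd_in \<alpha> (\<tau> * (\<tau> * w))"
      unfolding BS.dvd_in_def using BS.diff_mem[OF const_frac_mem xB] by blast
    then have "BS.dvd_in \<alpha> (\<tau> * w)"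
      using pa[OF mem(4) BS.mult_mem[OF mem(4) xw(2)]] \<tau>_not_dvd by blast
    then have "BS.dvd_in \<alpha> w" using pa[OF mem(4) xw(2)] \<tau>_not_dvd by blast
    then obtain w' where w': "w' \<in> B" "w = \<alpha> * w'" unfolding BS.dvd_in_def by blast
    have "\<alpha> * (const_frac c) = \<alpha> * (x + \<tau> * (\<tau> * w'))" using e w'(2) by (simp add: algebra_simps)
    then have "const_frac c = x + \<tau> * (\<tau> * w')" using \<alpha>0 by simp
    also have "\<dots> \<in> m" using xw w' mem
      by (intro BS.ideal_add[OF PI] BS.ideal_mult_right[OF PI] BS.mult_mem)
    finally have "c = 0" by (rule c0)
    with d show "c = 0 \<and> d = 0" by simp
  qed
qed

lemma cotangent_point:
  assumes m: "maximalideal m R" and am: "to_fract a \<notin> m"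
    and XY: "to_fract (shiftX x0) \<in> m" "to_fract (shiftY y0) \<in> m"
  shows "cotangent_dim_eq R (const_frac :: 'k \<Rightarrow> _) m 2"
proof -
  note P = maximalideal_unfold(1)[OF m]
  note PI = primeideal_unfold(1)[OF P]
  have mB: "m \<subseteq> B" using BS.ideal_sub[OF PI] by blast
  note sq = BS.ideal_ideal_square[OF mB]
  note prod = BS.mult_in_ideal_square[OF mB]
  note ev = to_fract_minus_eval2[OF PI XY]
  have a0: "eval2 x0 y0 a \<noteq> 0" by (rule eval2_a_nonzero[OF PI XY am])
  define X where "X = to_fract (shiftX x0)"
  define Y where "Y = to_fract (shiftY y0)"
  have mem: "X \<in> m" "Y \<in> m" using XY by (simp_all add: X_def Y_def)
  have ev0: "eval2 x0 y0 p = 0" if "to_fract p \<in> m" for p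
  proof -
    have "to_fract p - (to_fract p - const_frac (eval2 x0 y0 p)) \<in> m"
      by (rule BS.ideal_diff[OF PI that ev])
    then show ?thesis using const_frac_mem_ideal[OF PI primeideal_unfold(2)[OF P]] by simp
  qed
  show ?thesis
  proof (rule cotangent_dim_eq_2I[OF PI mem])
    fix g assume g: "g \<in> m"
    then have gB: "g \<in> B" using mB by blast
    obtain N p where p: "to_fract a ^ N * g = to_fract p" using B_clear_denominator gB by blast
    have "to_fract p \<in> m"
      using BS.ideal_mult[OF PI BS.power_mem[OF to_fract_mem] g] p by metis
    then have "eval2 x0 y0 p = 0" by (rule ev0)
    from eval2_eq_0_decomp2[OF this] obtain \<alpha> \<beta> u v w where
      d: "p = constA \<alpha> * shiftX x0 + constA \<beta> * shiftY y0 +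
       (shiftX x0 * shiftX x0 * u + shiftX x0 * shiftY y0 * v + shiftY y0 * shiftY y0 * w)"
      by (elim exE)
    \<comment> \<open>Modulo \<open>m\<close>, \<open>a^N\<close> is the nonzero constant
      \<open>?e\<close>, so \<open>p = a^N * g\<close> agrees with \<open>?e * g\<close> modulo
      \<open>m^2\<close>; the coordinates of \<open>g\<close> are the linear coefficients of
      \<open>p\<close> divided by \<open>?e\<close>.\<close>
    let ?e = "eval2 x0 y0 (a ^ N)"
    have e0: "?e \<noteq> 0" using a0 by simp
    have pe: "to_fract p = const_frac \<alpha> * X + const_frac \<beta> * Y +
      (X * X * to_fract u + X * Y * to_fract v + Y * Y * to_fract w)"
      unfolding d X_def Y_def const_frac_eq by (simp only: to_fract_add to_fract_mult)
    have q: "X * X * to_fract u + X * Y * to_fract v + Y * Y * to_fract w \<in> ideal_square R m"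
      using mem by (intro BS.ideal_add[OF sq] BS.ideal_mult_right[OF sq] prod) auto
    have "(to_fract (a ^ N) - const_frac ?e) * g \<in> ideal_square R m"
      using ev g by (intro prod)
    then have "const_frac (1 / ?e) * ((X * X * to_fract u + X * Y * to_fract v + Y * Y * to_fract w)
        - (to_fract (a ^ N) - const_frac ?e) * g) \<in> ideal_square R m"
      by (rule BS.ideal_mult[OF sq const_frac_mem BS.ideal_diff[OF sq q]])
    also have "const_frac (1 / ?e) * ((X * X * to_fract u + X * Y * to_fract v + Y * Y * to_fract w)
        - (to_fract (a ^ N) - const_frac ?e) * g) =
        (const_frac (1 / ?e) * const_frac ?e) * g -
          const_frac (1 / ?e) * (const_frac \<alpha> * X + const_frac \<beta> * Y)"
    proof -
      have "to_fract (a ^ N) * g = to_fract p" using p by (simp add: to_fract_power_a)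
      then have "X * X * to_fract u + X * Y * to_fract v + Y * Y * to_fract w =
        to_fract (a ^ N) * g - (const_frac \<alpha> * X + const_frac \<beta> * Y)"
        unfolding pe by simp
      moreover have "k * (q - (s - e) * g) = (k * e) * g - k * l" if "q = s * g - l"
        for k q s e g l :: "'k poly poly fract"
        unfolding that by (simp add: algebra_simps)
      ultimately show ?thesis by blast
    qed
    also have "\<dots> = g - (const_frac (1 / ?e * \<alpha>) * X + const_frac (1 / ?e * \<beta>) * Y)"
      unfolding const_frac_inverse[OF e0] const_frac_simps(6) by (simp add: algebra_simps)
    finally show "\<exists>c d. g - (const_frac c * X + const_frac d * Y) \<in> ideal_square R m" by blast
  next
    fix c d assume cd: "const_frac c * X + const_frac d * Y \<in> ideal_square R m"
    \<comment> \<open>\<open>flat\<close> means vanishing to second order at the point. Numerators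
      of elements of \<open>m\<close> vanish there, so by the Leibniz rule the product of two is
      flat, and \<open>J\<close> contains \<open>m^2\<close>.\<close>
    define flat where "flat p \<longleftrightarrow> eval2 x0 y0 p = 0 \<and> partialX x0 y0 p = 0 \<and> partialY x0 y0 p = 0" for p
    have flat_add: "flat (p + q)" if "flat p" "flat q" for p q
      using that by (simp add: flat_def partial_add)
    have flat_mult: "flat (q * p)" if "flat p" for p q
      using that by (simp add: flat_def partial_mult)
    define J where "J = {g\<in>B. \<exists>N p. to_fract a ^ N * g = to_fract p \<and> flat p}"
    have "flat 0" by (simp add: flat_def partialX_def partialY_def)
    then have J: "ideal J R" unfolding J_def using flat_add flat_mult by (intro ideal_localized)
    have "ideal_square R m \<subseteq> J"
    proof (rule BS.ideal_square_subset[OF J])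
      fix g h assume gh: "g \<in> m" "h \<in> m"
      then have B: "g \<in> B" "h \<in> B" using mB by auto
      obtain N p where p: "to_fract a ^ N * g = to_fract p" using B_clear_denominator B by blast
      obtain M q where q: "to_fract a ^ M * h = to_fract q" using B_clear_denominator B by blast
      have "eval2 x0 y0 p = 0"
        using BS.ideal_mult[OF PI BS.power_mem[OF to_fract_mem] gh(1), of a N] p by (intro ev0) simp
      moreover have "eval2 x0 y0 q = 0"
        using BS.ideal_mult[OF PI BS.power_mem[OF to_fract_mem] gh(2), of a M] q by (intro ev0) simp
      ultimately have fl: "flat (p * q)" by (simp add: flat_def partial_mult)
      have "to_fract a ^ (N + M) * (g * h) = (to_fract a ^ N * g) * (to_fract a ^ M * h)"
        by (simp add: power_add algebra_simps)
      also have "\<dots> = to_fract (p * q)" unfolding p q by simp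
      finally show "g * h \<in> J" unfolding J_def using fl BS.mult_mem[OF B] by blast
    qed
    then obtain N p where p: "to_fract a ^ N * (const_frac c * X + const_frac d * Y) = to_fract p" "flat p"
      using cd unfolding J_def by blast
    let ?l = "constA c * shiftX x0 + constA d * shiftY y0"
    have "to_fract (a ^ N * ?l) = to_fract p"
      using p(1) by (simp add: X_def Y_def const_frac_eq to_fract_power_a)
    then have "a ^ N * ?l = p" by (simp only: to_fract_eq_iff)
    then have "flat (a ^ N * ?l)" using p(2) by simp
    \<comment> \<open>The linear form vanishes at the point, so the partial derivatives of
      \<open>a^N * ?l\<close> are its coefficients scaled by \<open>a(x0, y0)^N\<close>.\<close>
    then have "eval2 x0 y0 a ^ N * c = 0 \<and> eval2 x0 y0 a ^ N * d = 0"
      unfolding flat_def by (simp add: partial_add partial_mult)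
    then show "c = 0 \<and> d = 0" using a0 by simp
  qed
qed

lemma krull_dim_B:
  assumes alg: "alg_closed_type TYPE('k)"
  shows "krull_dim R = 2"
proof -
  define C where "C n \<longleftrightarrow> (\<exists>P. (\<forall>i\<le>n. primeideal (P i) R) \<and> (\<forall>i<n. P i \<subset> P (Suc i)))" for n :: nat
  have "{0} \<noteq> B" using BS.one_mem by (metis singletonD zero_neq_one)
  then have zero: "primeideal {0} R"
    unfolding BS.primeideal_ring_of_iff BS.ideal_ring_of_iff using BS.zero_mem by auto
  have "{0} \<subset> exc_ideal"
  proof -
    have "to_fract a \<in> exc_ideal"
      unfolding exc_ideal_def BS.dvd_in_def using BS.one_mem by (auto intro!: bexI[of _ 1])
    then show ?thesis using BS.ideal_zero[OF ideal_exc] to_fract_a_nonzero by blast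
  qed
  moreover define P where "P i = (if i = 0 then {0} else if i = 1 then exc_ideal else exc_point)" for i :: nat
  ultimately have "C 2"
    unfolding C_def using zero primeideal_exc primeideal_exc_point exc_ideal_subset
    by (intro exI[of _ P]) (auto simp: less_2_cases_iff)
  moreover have "n \<le> 2" if Cn: "C n" for n
  proof (rule ccontr)
    assume "\<not> n \<le> 2"
    obtain P where P: "\<And>i. i \<le> n \<Longrightarrow> primeideal (P i) R" "\<And>i. i < n \<Longrightarrow> P i \<subset> P (Suc i)"
      using Cn unfolding C_def by blast
    have chain: "P 0 \<subset> P 1" "P 1 \<subset> P 2" "P 2 \<subset> P 3"
      using P(2)[of 0] P(2)[of 1] P(2)[of 2] \<open>\<not> n \<le> 2\<close> by (simp_all add: numeral_3_eq_3 numeral_2_eq_2)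
    have prm: "primeideal (P 0) R" "primeideal (P 1) R" "primeideal (P 2) R" "primeideal (P 3) R"
      using P(1) \<open>\<not> n \<le> 2\<close> by simp_all
    \<comment> \<open>\<open>P 1\<close> is nonzero because it lies strictly above
      \<open>P 0\<close>; hence \<open>P 2\<close> is residual and has no proper ideal such as
      \<open>P 3\<close> strictly above it.\<close>
    obtain q where "q \<in> P 1" "q \<notin> P 0" using chain by blast
    moreover from this have "q \<noteq> 0" using BS.ideal_zero[OF primeideal_unfold(1)[OF prm(1)]] by auto
    ultimately have "residual (P 2)"
      using primeideal_chain_residual[OF alg prm(2,3) chain(2)] by blast
    then have "P 3 = P 2"
      by (rule residual_maximal) (use prm primeideal_unfold chain in auto)
    then show False using chain by simp
  qed
  ultimately have "Sup {enat n |n. C n} = enat 2"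
    by (intro antisym Sup_least Sup_upper) auto
  then show ?thesis unfolding krull_dim_def C_def by (simp add: numeral_eq_enat)
qed

lemma smooth_affine_surface_B:
  assumes alg: "alg_closed_type TYPE('k)"
  shows "smooth_affine_surface (B_ring a b) (const_frac :: 'k \<Rightarrow> _)"
  unfolding smooth_affine_surface_def B_ring_def
proof (intro conjI allI impI)
  fix m assume m: "maximalideal m R"
  from maximalideal_cases[OF alg m] show "cotangent_dim_eq R (const_frac :: 'k \<Rightarrow> _) m 2"
    using cotangent_exceptional[OF m] cotangent_point[OF m] by blast
qed (rule krull_dim_B[OF alg])

end

theorem theorem3p1:
  fixes a b :: "'k::field poly poly"
  assumes "kalg_iso (quotA (PIdl\<^bsub>polyA\<^esub> a)) (const_quotA (PIdl\<^bsub>polyA\<^esub> a))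
                    laurent_ring const_laurent"
    and "kalg_iso (quotA (PIdl\<^bsub>polyA\<^esub> b)) (const_quotA (PIdl\<^bsub>polyA\<^esub> b))
                    poly_ring (\<lambda>c. [:c:])"
    and "kalg_iso (quotA (genideal polyA {a, b})) (const_quotA (genideal polyA {a, b}))
                    field_ring id"
  shows "(factorial_domain (B_ring a b)
        \<and> Units (B_ring a b) = const_frac ` {c. c \<noteq> 0})
     \<and> (alg_closed_type TYPE('k) \<longrightarrow>
         smooth_affine_surface (B_ring a b) const_frac
       \<and> factorial_domain (B_ring a b)
       \<and> Units (B_ring a b) = const_frac ` {c. c \<noteq> 0})"
proof -
  \<comment> \<open>Otherwise \<open>(a, b) = aA\<close>, and every class modulo \<open>a\<close>
    would be constant, contrary to the class of \<open>t\<close>.\<close>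
  have "\<not> a dvd b"
  proof
    assume "a dvd b"
    then obtain w where w: "b = a * w" by (elim dvdE)
    obtain z where z: "\<forall>c w. z \<noteq> constA c + w * a" using quot_laurent_nonconst[OF assms(1)] by blast
    obtain c u v where "z = constA c + u * a + v * b" using quot_field_decomp[OF assms(3)] by blast
    then have "z = constA c + (u + v * w) * a" by (simp add: w algebra_simps)
    then show False using z by blast
  qed
  then interpret affine_modification a b
    using quot_laurent_prime[OF assms(1)] quot_field_decomp[OF assms(3)] quot_field_proper[OF assms(3)]
    by unfold_locales
  show ?thesis using factorial_domain_B Units_B smooth_affine_surface_B by blast
qed

end
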